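(* Let $\varphi=\{\varphi^t\}_{t\ge0}$ be a semiflow in a real Banach space $\mathbb{E}$. Suppose there are a symmetric operator $P\in\mathcal{L}(\mathbb{E};\mathbb{E}^* )$ and a direct sum decomposition $\mathbb{E}=\mathbb{E}^+\oplus\mathbb{E}^-$ with $\dim\mathbb{E}^-=2$ such that $V(v):=\langle v,Pv\rangle$ is positive on $\mathbb{E}^+\setminus\{0\}$ and negative on $\mathbb{E}^-\setminus\{0\}$, and that $\varphi$ satisfies the squeezing property with respect to $V$, asymptotic compactness with exponent $\gamma^+=\nu^+$ and the uniform Lipschitz property. Then the $\omega$-limit set $\omega(v_0)$ of any point $v_0\in\mathbb{E}$ with a bounded (positive) semiorbit is one of the following: (1) a stationary point; (2) a periodic orbit; (3) a union of some set of stationary points $\mathcal{N}$ and a set of complete orbits whose $\alpha$- and $\omega$-limit sets lie in $\mathcal{N}$.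
   Context: $\mathbb{R}_+=[0,\infty)$. $\mathbb{E}$ is continuously embedded in a Hilbert space $\mathbb{H}$ with norm $|\cdot|_{\mathbb{H}}$. A semiflow: $\varphi^0=\mathrm{id}$, $\varphi^{t+s}=\varphi^t\circ\varphi^s$, $(t,v)\mapsto\varphi^t(v)$ continuous on $\mathbb{R}_+\times\mathbb{E}$. $P$ is symmetric if $\langle v_1,Pv_2\rangle=\langle v_2,Pv_1\rangle$ for all $v_1,v_2\in\mathbb{E}$. Squeezing property: there are constants $\nu^-<\nu^+$, $\delta_P>0$, $\tau_P\ge0$ and $\nu_0\in\mathbb{R}_+$ with $\nu^-\le\nu_0\le\nu^+$ such that $$e^{2\nu_0r}V(\varphi^r(v_1)-\varphi^r(v_2))-e^{2\nu_0l}V(\varphi^l(v_1)-\varphi^l(v_2))\le-\delta_P\int_l^re^{2\nu_0s}|\varphi^s(v_1)-\varphi^s(v_2)|^2_{\mathbb{H}}ds$$ for all $v_1,v_2\in\mathbb{E}$ and $r,l\ge0$ with $r-l\ge\tau_P$. Uniform Lipschitz property: there is $\tau_S\ge0$ such that for every $T>0$ there is $L_T>0$ with $\|\varphi^t(v_1)-\varphi^t(v_2)\|_{\mathbb{E}}\le L_T|v_1-v_2|_{\mathbb{H}}$ for $t\in[\tau_S,\tau_S+T]$ and $\|\varphi^t(v_1)-\varphi^t(v_2)\|_{\mathbb{E}}\le L_T\|v_1-v_2\|_{\mathbb{E}}$ for $t\in[0,T]$, for all $v_1,v_2\in\mathbb{E}$. Asymptotic compactness with exponent $\gamma^+$: there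 is $\gamma_0\colon\mathbb{R}_+\to\mathbb{R}_+$ with $\gamma_0(t)\to0$ as $t\to+\infty$ and $\alpha_K(\varphi^t(\mathcal{B}))\le\gamma_0(t)e^{-\gamma^+t}\alpha_K(\mathcal{B})$ for all $t\ge0$ and bounded $\mathcal{B}\subset\mathbb{E}$, where $\alpha_K$ is the Kuratowski measure of noncompactness in $\mathbb{E}$. *)

theory Defs
  imports "HOL-Analysis.Analysis"
begin

(* Time is real-valued throughout; the values phi t for t < 0 are irrelevant. *)
definition semiflow :: "(real \<Rightarrow> 'e \<Rightarrow> 'e::topological_space) \<Rightarrow> bool" where
  "semiflow \<phi> \<longleftrightarrow>
     (\<forall>v. \<phi> 0 v = v) \<and>
     (\<forall>t\<ge>0. \<forall>s\<ge>0. \<forall>v. \<phi> (t + s) v = \<phi> t (\<phi> s v)) \<and>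
     continuous_on ({0..} \<times> UNIV) (\<lambda>(t, v). \<phi> t v)"

(* P is a bounded operator into the dual space, <v, f> being f v, so <v, P w> is P w v. *)
definition symmetric_op :: "('e::real_normed_vector \<Rightarrow>\<^sub>L ('e \<Rightarrow>\<^sub>L real)) \<Rightarrow> bool" where
  "symmetric_op P \<longleftrightarrow>
     (\<forall>v w. blinfun_apply (blinfun_apply P w) v = blinfun_apply (blinfun_apply P v) w)"

definition quad_form :: "('e::real_normed_vector \<Rightarrow>\<^sub>L ('e \<Rightarrow>\<^sub>L real)) \<Rightarrow> 'e \<Rightarrow> real" where
  "quad_form P v = blinfun_apply (blinfun_apply P v) v"

definition direct_sum_decomp :: "'e::real_vector set \<Rightarrow> 'e set \<Rightarrow> bool" where
  "direct_sum_decomp A B \<longleftrightarrow>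
     subspace A \<and> subspace B \<and> A \<inter> B = {0} \<and> (\<forall>v. \<exists>a\<in>A. \<exists>b\<in>B. v = a + b)"

definition continuous_embedding :: "('e::real_normed_vector \<Rightarrow> 'h::real_normed_vector) \<Rightarrow> bool" where
  "continuous_embedding \<iota> \<longleftrightarrow> bounded_linear \<iota> \<and> inj \<iota>"

(* In the next two definitions the norm of v in the Hilbert space is norm (\<iota> v),
   \<iota> being the embedding. *)
definition squeezing_property ::
  "('e::real_normed_vector \<Rightarrow> 'h::real_normed_vector) \<Rightarrow> ('e \<Rightarrow> real) \<Rightarrow>
   (real \<Rightarrow> 'e \<Rightarrow> 'e) \<Rightarrow> real \<Rightarrow> real \<Rightarrow> bool" where
  "squeezing_property \<iota> V \<phi> \<nu>m \<nu>p \<longleftrightarrow>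
     \<nu>m < \<nu>p \<and>
     (\<exists>\<delta>>0. \<exists>\<tau>\<ge>0. \<exists>\<nu>0\<ge>0. \<nu>m \<le> \<nu>0 \<and> \<nu>0 \<le> \<nu>p \<and>
       (\<forall>v1 v2. \<forall>r\<ge>0. \<forall>l\<ge>0. r - l \<ge> \<tau> \<longrightarrow>
          exp (2 * \<nu>0 * r) * V (\<phi> r v1 - \<phi> r v2) - exp (2 * \<nu>0 * l) * V (\<phi> l v1 - \<phi> l v2)
            \<le> - \<delta> * integral {l..r} (\<lambda>s. exp (2 * \<nu>0 * s) * (norm (\<iota> (\<phi> s v1 - \<phi> s v2)))\<^sup>2)))"

definition uniform_lipschitz_property ::
  "('e::real_normed_vector \<Rightarrow> 'h::real_normed_vector) \<Rightarrow> (real \<Rightarrow> 'e \<Rightarrow> 'e) \<Rightarrow> bool" where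
  "uniform_lipschitz_property \<iota> \<phi> \<longleftrightarrow>
     (\<exists>\<tau>\<ge>0. \<forall>T>0. \<exists>L>0. \<forall>v1 v2.
        (\<forall>t\<in>{\<tau>..\<tau> + T}. norm (\<phi> t v1 - \<phi> t v2) \<le> L * norm (\<iota> (v1 - v2))) \<and>
        (\<forall>t\<in>{0..T}. norm (\<phi> t v1 - \<phi> t v2) \<le> L * norm (v1 - v2)))"

(* Valued in ennreal so that it is infinite on unbounded sets. Boundedness of the pieces
   is explicit because diameter is only meaningful for bounded sets. *)
definition kuratowski :: "'a::metric_space set \<Rightarrow> ennreal" where
  "kuratowski B = Inf {ennreal d | d. d \<ge> 0 \<and>
     (\<exists>F. finite F \<and> B \<subseteq> \<Union>F \<and> (\<forall>S\<in>F. bounded S \<and> diameter S \<le> d))}"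

definition asymptotically_compact ::
  "(real \<Rightarrow> 'e \<Rightarrow> 'e::metric_space) \<Rightarrow> real \<Rightarrow> bool" where
  "asymptotically_compact \<phi> \<gamma>p \<longleftrightarrow>
     (\<exists>\<gamma>0 :: real \<Rightarrow> real. (\<forall>t\<ge>0. \<gamma>0 t \<ge> 0) \<and> (\<gamma>0 \<longlongrightarrow> 0) at_top \<and>
       (\<forall>t\<ge>0. \<forall>B. bounded B \<longrightarrow>
          kuratowski (\<phi> t ` B) \<le> ennreal (\<gamma>0 t * exp (- \<gamma>p * t)) * kuratowski B))"

definition semiorbit :: "(real \<Rightarrow> 'e \<Rightarrow> 'e) \<Rightarrow> 'e \<Rightarrow> 'e set" where
  "semiorbit \<phi> v = (\<lambda>t. \<phi> t v) ` {0..}"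

definition stationary_point :: "(real \<Rightarrow> 'e \<Rightarrow> 'e) \<Rightarrow> 'e \<Rightarrow> bool" where
  "stationary_point \<phi> w \<longleftrightarrow> (\<forall>t\<ge>0. \<phi> t w = w)"

definition periodic_orbit :: "(real \<Rightarrow> 'e \<Rightarrow> 'e) \<Rightarrow> 'e set \<Rightarrow> bool" where
  "periodic_orbit \<phi> A \<longleftrightarrow>
     (\<exists>w. \<exists>T>0. \<phi> T w = w \<and> \<not> stationary_point \<phi> w \<and> A = semiorbit \<phi> w)"

definition complete_trajectory :: "(real \<Rightarrow> 'e \<Rightarrow> 'e) \<Rightarrow> (real \<Rightarrow> 'e) \<Rightarrow> bool" where
  "complete_trajectory \<phi> u \<longleftrightarrow> (\<forall>s. \<forall>t\<ge>0. u (t + s) = \<phi> t (u s))"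

definition omega_limit :: "(real \<Rightarrow> 'e::topological_space) \<Rightarrow> 'e set" where
  "omega_limit u = {w. \<exists>t. filterlim t at_top sequentially \<and> (\<lambda>n. u (t n)) \<longlonglongrightarrow> w}"

definition alpha_limit :: "(real \<Rightarrow> 'e::topological_space) \<Rightarrow> 'e set" where
  "alpha_limit u = {w. \<exists>t. filterlim t at_bot sequentially \<and> (\<lambda>n. u (t n)) \<longlonglongrightarrow> w}"

end

theory Submission
  imports Defs "HOL-Library.Diagonal_Subsequence"
begin

text \<open>
  The limit set lies on a surface on which the semiflow is a planar flow, and there the
  Poincare-Bendixson theorem applies.

  The surface. Combined with the smoothing part of the Lipschitz property, the squeezing property says
  that \<open>exp (2 * lam * t) * V (u1 t - u2 t)\<close> decreases along any two solutions, by at least a multiple of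
  the weighted squared norm of their difference (\<open>squeezing_controls_norm\<close>). Consider the complete
  trajectories that grow at most like \<open>exp (- lam * t)\<close> backward in time. For two of them the weighted
  form tends to 0 in the far past, so \<open>V\<close> is negative on their difference unless they coincide
  (\<open>amenable_pair_form\<close>). As \<open>V\<close> is negative on a plane only, such a trajectory is determined by two
  coordinates \<open>Q\<close> of its state at time 0, with a Lipschitz inverse. All values of the coordinates occur
  (\<open>amenable_exists\<close>): trajectories that start in the negative plane long ago can be steered to any
  of them by invariance of domain, and they accumulate because the measure of noncompactness decays
  faster than they can have grown. Hence time evolution of these trajectories is a continuous flow on
  the plane of coordinates.

  The given solution need not lie on this surface, but it converges to a trajectory on it, for which
  \<open>V\<close> of the difference stays nonnegative forever (\<open>asymptotic_phase\<close>). So both have the same limit set.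

  The plane. Here the flow is only continuous, so transversal curves are not at hand. Their place is
  taken by level sets of time averages (\<open>local_section\<close>). An arc in such a section and a piece of
  orbit between consecutive crossings form a Jordan curve that orbits cross in one direction only
  (\<open>trap\<close>). Therefore a trajectory in the limit set that is recurrent near a point not at rest is
  periodic, and a nonconstant periodic orbit in the limit set is all of it. If there is none, all limit points of
  trajectories in the limit set are at rest.
\<close>

section \<open>Limit sets\<close>

lemma omega_limit_visits:
  assumes "w \<in> omega_limit u" "open W" "w \<in> W"
  obtains t where "T \<le> t" "u t \<in> W"
proof -
  obtain t where t: "filterlim t at_top sequentially" "(\<lambda>n. u (t n)) \<longlonglongrightarrow> w"
    using assms(1) by (auto simp: omega_limit_def)
  have "\<forall>\<^sub>F n in sequentially. T \<le> t n" using t(1) by (simp add: filterlim_at_top)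
  moreover have "\<forall>\<^sub>F n in sequentially. u (t n) \<in> W" using t(2) assms topological_tendstoD by blast
  ultimately have "\<forall>\<^sub>F n in sequentially. T \<le> t n \<and> u (t n) \<in> W" by (rule eventually_conj)
  then show ?thesis using that eventually_happens'[OF sequentially_bot] by blast
qed

lemma alpha_limit_visits:
  assumes "w \<in> alpha_limit u" "open W" "w \<in> W"
  obtains t where "t \<le> T" "u t \<in> W"
proof -
  obtain t where t: "filterlim t at_bot sequentially" "(\<lambda>n. u (t n)) \<longlonglongrightarrow> w"
    using assms(1) by (auto simp: alpha_limit_def)
  have "\<forall>\<^sub>F n in sequentially. t n \<le> T" using t(1) by (simp add: filterlim_at_bot)
  moreover have "\<forall>\<^sub>F n in sequentially. u (t n) \<in> W" using t(2) assms topological_tendstoD by blast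
  ultimately have "\<forall>\<^sub>F n in sequentially. t n \<le> T \<and> u (t n) \<in> W" by (rule eventually_conj)
  then show ?thesis using that eventually_happens'[OF sequentially_bot] by blast
qed

lemma omega_limit_closed_subset:
  fixes u :: "real \<Rightarrow> 'a::topological_space"
  assumes "closed A" "range u \<subseteq> A"
  shows "omega_limit u \<subseteq> A"
proof
  fix w assume "w \<in> omega_limit u"
  then show "w \<in> A"
    using omega_limit_visits[of w u "- A" 0] assms by (meson ComplD ComplI open_Compl rangeI subsetD)
qed

lemma omega_limit_metric_iff:
  fixes u :: "real \<Rightarrow> 'a::metric_space"
  shows "w \<in> omega_limit u \<longleftrightarrow> (\<forall>T. \<forall>e>0. \<exists>t\<ge>T. dist (u t) w < e)"
proof (intro iffI allI impI)
  fix T and e :: real assume w: "w \<in> omega_limit u" and "0 < e"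
  then show "\<exists>t\<ge>T. dist (u t) w < e"
    using omega_limit_visits[OF w open_ball, of w e T] by (auto simp: dist_commute)
next
  assume *: "\<forall>T. \<forall>e>0. \<exists>t\<ge>T. dist (u t) w < e"
  have "\<exists>t. real n \<le> t \<and> dist (u t) w < inverse (real (Suc n))" for n :: nat
    using *[rule_format, of "inverse (real (Suc n))" "real n"] by auto
  then obtain t where t: "\<And>n. real n \<le> t n" "\<And>n. dist (u (t n)) w < inverse (real (Suc n))" by metis
  have "filterlim t at_top sequentially"
    by (rule filterlim_at_top_mono[OF filterlim_real_sequentially]) (simp add: t(1))
  moreover have "(\<lambda>n. u (t n)) \<longlonglongrightarrow> w"
    using t(2) by (intro metric_tendsto_imp_tendsto[OF LIMSEQ_inverse_real_of_nat])
      (auto intro!: always_eventually less_imp_le)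
  ultimately show "w \<in> omega_limit u" by (auto simp: omega_limit_def)
qed

text \<open>A limit of points \<open>R (x t)\<close> cannot leave \<open>range R\<close>, since \<open>Q\<close> maps it to a limit of the
parameters \<open>x t\<close>.\<close>

lemma omega_limit_image:
  fixes R :: "'a::t2_space \<Rightarrow> 'b::t2_space"
  assumes R: "continuous_on UNIV R" and Q: "continuous_on UNIV Q" and QR: "\<And>c. Q (R c) = c"
  shows "omega_limit (\<lambda>t. R (x t)) = R ` omega_limit x" "alpha_limit (\<lambda>t. R (x t)) = R ` alpha_limit x"
proof -
  have R': "(\<lambda>n. R (f n)) \<longlonglongrightarrow> R c" if "f \<longlonglongrightarrow> c" for f c
    using R that by (intro isCont_tendsto_compose[of _ R]) (simp_all add: continuous_on_eq_continuous_at)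
  have *: "\<exists>c. f \<longlonglongrightarrow> c \<and> w = R c" if "(\<lambda>n. R (f n)) \<longlonglongrightarrow> w" for f w
  proof -
    have "(\<lambda>n. Q (R (f n))) \<longlonglongrightarrow> Q w"
      using Q that by (intro isCont_tendsto_compose[of _ Q]) (simp_all add: continuous_on_eq_continuous_at)
    then have f: "f \<longlonglongrightarrow> Q w" by (simp add: QR)
    from LIMSEQ_unique[OF that R'[OF f]] f show ?thesis by blast
  qed
  show "omega_limit (\<lambda>t. R (x t)) = R ` omega_limit x"
  proof
    show "R ` omega_limit x \<subseteq> omega_limit (\<lambda>t. R (x t))"
      using R' unfolding omega_limit_def by blast
    show "omega_limit (\<lambda>t. R (x t)) \<subseteq> R ` omega_limit x"
    proof
      fix w assume "w \<in> omega_limit (\<lambda>t. R (x t))"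
      then obtain t where t: "filterlim t at_top sequentially" "(\<lambda>n. R (x (t n))) \<longlonglongrightarrow> w"
        by (auto simp: omega_limit_def)
      with *[OF t(2)] show "w \<in> R ` omega_limit x" by (auto simp: omega_limit_def)
    qed
  qed
  show "alpha_limit (\<lambda>t. R (x t)) = R ` alpha_limit x"
  proof
    show "R ` alpha_limit x \<subseteq> alpha_limit (\<lambda>t. R (x t))"
      using R' unfolding alpha_limit_def by blast
    show "alpha_limit (\<lambda>t. R (x t)) \<subseteq> R ` alpha_limit x"
    proof
      fix w assume "w \<in> alpha_limit (\<lambda>t. R (x t))"
      then obtain t where t: "filterlim t at_bot sequentially" "(\<lambda>n. R (x (t n))) \<longlonglongrightarrow> w"
        by (auto simp: alpha_limit_def)
      with *[OF t(2)] show "w \<in> R ` alpha_limit x" by (auto simp: alpha_limit_def)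
    qed
  qed
qed

lemma omega_limit_asymptotic:
  fixes u v :: "real \<Rightarrow> 'a::real_normed_vector"
  assumes "((\<lambda>t. u t - v t) \<longlongrightarrow> 0) at_top"
  shows "omega_limit u = omega_limit v"
proof -
  have sub: "omega_limit u \<subseteq> omega_limit v" if "((\<lambda>t. u t - v t) \<longlongrightarrow> 0) at_top" for u v :: "real \<Rightarrow> 'a"
  proof
    fix w assume "w \<in> omega_limit u"
    then obtain t where t: "filterlim t at_top sequentially" "(\<lambda>n. u (t n)) \<longlonglongrightarrow> w"
      by (auto simp: omega_limit_def)
    have "(\<lambda>n. u (t n) - (u (t n) - v (t n))) \<longlonglongrightarrow> w - 0"
      by (intro tendsto_diff t filterlim_compose[OF that t(1)])
    then show "w \<in> omega_limit v" using t(1) by (auto simp: omega_limit_def)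
  qed
  have "((\<lambda>t. v t - u t) \<longlongrightarrow> 0) at_top" using tendsto_minus[OF assms] by simp
  with sub assms show ?thesis by blast
qed

section \<open>The Poincare-Bendixson theorem for continuous flows in the plane\<close>

locale plane_flow =
  fixes \<psi> :: "real \<Rightarrow> complex \<Rightarrow> complex"
  assumes flow_zero [simp]: "\<psi> 0 x = x"
    and flow_add: "\<psi> (s + t) x = \<psi> s (\<psi> t x)"
    and flow_cont: "continuous_on UNIV (\<lambda>(t, x). \<psi> t x)"
begin

lemma flow_continuous_on [continuous_intros]:
  assumes "continuous_on A f" "continuous_on A g"
  shows "continuous_on A (\<lambda>a. \<psi> (f a) (g a))"
  using continuous_on_compose2[OF flow_cont continuous_on_Pair[OF assms]] by simp

lemma flow_tendsto:
  assumes "(f \<longlongrightarrow> t) F" "(g \<longlongrightarrow> x) F"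
  shows "((\<lambda>a. \<psi> (f a) (g a)) \<longlongrightarrow> \<psi> t x) F"
proof -
  have "isCont (\<lambda>(t, x). \<psi> t x) (t, x)"
    using flow_cont continuous_on_eq_continuous_at by blast
  from isCont_tendsto_compose[OF this tendsto_Pair[OF assms]] show ?thesis by simp
qed

lemma flow_inverse [simp]: "\<psi> t (\<psi> (- t) x) = x" "\<psi> (- t) (\<psi> t x) = x"
  using flow_add[of t "-t" x] flow_add[of "-t" t x] by simp_all

lemma flow_near:
  assumes "0 < e"
  obtains d where "0 < d" "\<And>s v. \<bar>s - t\<bar> < d \<Longrightarrow> dist v z < d \<Longrightarrow> dist (\<psi> s v) (\<psi> t z) < e"
proof -
  have "isCont (\<lambda>(t, x). \<psi> t x) (t, z)"
    using flow_cont continuous_on_eq_continuous_at by blast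
  with assms obtain d where d: "d > 0"
      "\<And>p. dist p (t, z) < d \<Longrightarrow> dist ((\<lambda>(t, x). \<psi> t x) p) (\<psi> t z) < e"
    unfolding continuous_at_eps_delta by (metis case_prod_conv)
  have "dist (\<psi> s v) (\<psi> t z) < e" if "\<bar>s - t\<bar> < d/2" "dist v z < d/2" for s v
  proof -
    have "dist (s, v) (t, z) \<le> \<bar>s - t\<bar> + dist v z"
      by (metis dist_Pair_Pair dist_real_def real_sqrt_sum_squares_triangle_ineq sqrt_sum_squares_le_sum abs_ge_zero zero_le_dist)
    with that d(2)[of "(s, v)"] show ?thesis by simp
  qed
  with d(1) that[of "d/2"] show ?thesis by simp
qed

lemma flow_near_compact:
  assumes "0 < e"
  obtains d where "0 < d" "\<And>s v. a \<le> s \<Longrightarrow> s \<le> b \<Longrightarrow> dist v z < d \<Longrightarrow> dist (\<psi> s v) (\<psi> s z) < e"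
proof -
  have "uniformly_continuous_on ({a..b} \<times> cball z 1) (\<lambda>(t, x). \<psi> t x)"
    by (intro compact_uniformly_continuous continuous_on_subset[OF flow_cont] compact_Times) auto
  with assms obtain d where d: "d > 0"
    "\<And>p q. p \<in> {a..b} \<times> cball z 1 \<Longrightarrow> q \<in> {a..b} \<times> cball z 1 \<Longrightarrow> dist q p < d \<Longrightarrow>
       dist ((\<lambda>(t, x). \<psi> t x) q) ((\<lambda>(t, x). \<psi> t x) p) < e"
    unfolding uniformly_continuous_on_def by metis
  have "dist (\<psi> s v) (\<psi> s z) < e" if "a \<le> s" "s \<le> b" "dist v z < min d 1" for s v
    using d(2)[of "(s, z)" "(s, v)"] that by (auto simp: dist_Pair_Pair dist_commute)
  with d(1) that[of "min d 1"] show ?thesis by simp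
qed

text \<open>The section is a level set of a time average. With \<open>h\<close> such that \<open>\<psi> h z \<noteq> z\<close> and the
linear functional \<open>f\<close> that separates \<open>\<psi> h z\<close> from \<open>z\<close>, the derivative of
\<open>g v = integral {0..h} (\<lambda>s. f (\<psi> s v))\<close> along the flow is \<open>f (\<psi> h v) - f v\<close>, which is positive
near \<open>z\<close>, although \<open>\<psi>\<close> itself need not be differentiable. So every orbit crosses the level of
\<open>z\<close> exactly once during a short time interval, and \<open>r\<close> moves a point to this crossing.\<close>

lemma local_section:
  assumes "\<psi> h0 z \<noteq> z"
  obtains S r and \<epsilon> \<rho> :: real where "0 < \<epsilon>" "0 < \<rho>"
    "\<And>s t. s \<in> S \<Longrightarrow> 0 < \<bar>t\<bar> \<Longrightarrow> \<bar>t\<bar> < \<epsilon> \<Longrightarrow> \<psi> t s \<notin> S"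
    "continuous_on (ball z \<rho>) r" "r z = z"
    "\<And>v. v \<in> ball z \<rho> \<Longrightarrow> r v \<in> S"
    "\<And>v. v \<in> ball z \<rho> \<Longrightarrow> \<exists>t. \<bar>t\<bar> < \<epsilon> \<and> r v = \<psi> t v"
proof -
  (* If time h0 moves z, then so does time - h0. *)
  define h where "h = \<bar>h0\<bar>"
  have "\<psi> (-h0) z \<noteq> z" using assms by (metis flow_inverse(1))
  then have hz: "\<psi> h z \<noteq> z" using assms by (auto simp: h_def abs_if)
  have h: "h > 0" using hz by (cases "h0 = 0") (auto simp: h_def)
  define w where "w = \<psi> h z - z"
  define f where "f v = (v - z) \<bullet> w" for v
  define d where "d = w \<bullet> w"
  have d: "d > 0" using hz by (simp add: d_def w_def)
  have f_lip: "\<bar>f u - f v\<bar> \<le> dist u v * norm w" for u v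
  proof -
    have "f u - f v = (u - v) \<bullet> w" by (simp add: f_def algebra_simps inner_diff_left)
    then show ?thesis by (metis Cauchy_Schwarz_ineq2 dist_norm)
  qed
  have nw: "norm w > 0" using hz by (simp add: w_def)
  have e0: "0 < d / (3 * norm w)" using d nw by simp
  obtain d1 where d1: "0 < d1" "\<And>s v. \<bar>s - 0\<bar> < d1 \<Longrightarrow> dist v z < d1 \<Longrightarrow> dist (\<psi> s v) (\<psi> 0 z) < d / (3 * norm w)"
    using flow_near[OF e0, of 0 z] by blast
  obtain d2 where d2: "0 < d2" "\<And>s v. \<bar>s - h\<bar> < d2 \<Longrightarrow> dist v z < d2 \<Longrightarrow> dist (\<psi> s v) (\<psi> h z) < d / (3 * norm w)"
    using flow_near[OF e0, of h z] by blast
  define e1 where "e1 = min d1 d2"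
  have e1: "e1 > 0" using d1 d2 by (simp add: e1_def)
  have fz: "f z = 0" "f (\<psi> h z) = d" by (simp_all add: f_def d_def w_def)
  have flo: "f (\<psi> s v) \<le> d/3" if "\<bar>s\<bar> < e1" "dist v z < e1" for s v
  proof -
    have "dist (\<psi> s v) z < d / (3 * norm w)" using d1(2)[of s v] that by (simp add: e1_def)
    then have "dist (\<psi> s v) z * norm w < d/3" using nw by (simp add: field_simps)
    with f_lip[of "\<psi> s v" z] fz show ?thesis by simp
  qed
  have fhi: "f (\<psi> s v) \<ge> 2*d/3" if "\<bar>s - h\<bar> < e1" "dist v z < e1" for s v
  proof -
    have "dist (\<psi> s v) (\<psi> h z) < d / (3 * norm w)" using d2(2)[of s v] that by (simp add: e1_def)
    then have "dist (\<psi> s v) (\<psi> h z) * norm w < d/3" using nw by (simp add: field_simps)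
    with f_lip[of "\<psi> s v" "\<psi> h z"] fz show ?thesis by (simp add: abs_le_iff)
  qed
  define g where "g v = integral {0..h} (\<lambda>s. f (\<psi> s v))" for v
  have fcont: "continuous_on A (\<lambda>s. f (k s))" if "continuous_on A k" for A k
    unfolding f_def by (intro continuous_intros that)
  have g_cont: "continuous_on UNIV g"
  proof -
    have "continuous_on UNIV (\<lambda>v. integral (cbox 0 h) (\<lambda>s. f (\<psi> s v)))"
      by (rule integral_continuous_on_param)
         (auto simp: case_prod_beta intro!: fcont continuous_intros)
    then show ?thesis by (simp add: g_def[abs_def] box_real)
  qed
  have int: "(\<lambda>s. f (\<psi> s v)) integrable_on {a..b}" for v a b
    by (intro integrable_continuous_real fcont continuous_intros)
  have g_shift: "g (\<psi> t v) = integral {t..t+h} (\<lambda>s. f (\<psi> s v))" for t v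
  proof -
    have "g (\<psi> t v) = integral {0..h} ((\<lambda>s. f (\<psi> s v)) \<circ> (+) t)"
      by (simp add: g_def o_def flow_add[symmetric] add.commute)
    also have "\<dots> = integral {t..t+h} (\<lambda>s. f (\<psi> s v))"
      by (simp add: integral_shift_Icc_real add.commute)
    finally show ?thesis .
  qed
  (* Shifting the window of the average from s to t adds a piece where f is at least 2d/3 and
     removes an equally long piece where f is at most d/3. *)
  have mono: "g (\<psi> s v) < g (\<psi> t v)" if "s < t" "\<bar>s\<bar> < e1" "\<bar>t\<bar> < e1" "dist v z < e1" for s t v
  proof -
    let ?F = "\<lambda>s. f (\<psi> s v)"
    have 1: "integral {s..s+h} ?F + integral {s+h..t+h} ?F = integral {s..t+h} ?F"
      by (rule Henstock_Kurzweil_Integration.integral_combine) (use h that int in auto)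
    have 2: "integral {s..t} ?F + integral {t..t+h} ?F = integral {s..t+h} ?F"
      by (rule Henstock_Kurzweil_Integration.integral_combine) (use h that int in auto)
    have 3: "integral {s..t} ?F \<le> integral {s..t} (\<lambda>_. d/3)"
      by (rule integral_le[OF int]) (use that flo in auto)
    have 4: "integral {s+h..t+h} (\<lambda>_. 2*d/3) \<le> integral {s+h..t+h} ?F"
      by (rule integral_le[OF _ int]) (use that fhi in auto)
    have 5: "integral {s..t} (\<lambda>_. d/3) < integral {s+h..t+h} (\<lambda>_. 2*d/3)"
      using that d by simp
    show ?thesis unfolding g_shift using 1 2 3 4 5 by linarith
  qed
  obtain d3 where d3: "0 < d3" "\<And>s v. \<bar>s - 0\<bar> < d3 \<Longrightarrow> dist v z < d3 \<Longrightarrow> dist (\<psi> s v) (\<psi> 0 z) < e1"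
    using flow_near[OF e1, of 0 z] by blast
  define \<epsilon> where "\<epsilon> = min d3 e1 / 2"
  have \<epsilon>: "0 < \<epsilon>" "\<epsilon> < d3" "\<epsilon> < e1" using d3(1) e1 by (auto simp: \<epsilon>_def)
  have gz: "g (\<psi> (-\<epsilon>) z) < g z" "g z < g (\<psi> \<epsilon> z)"
    using mono[of "-\<epsilon>" 0 z] mono[of 0 \<epsilon> z] \<epsilon> e1 by auto
  have gcomp: "continuous_on UNIV (\<lambda>v. g (\<psi> t v))" for t
    by (rule continuous_on_compose2[OF g_cont]) (auto intro!: continuous_intros)
  have nb: "open ({v. g (\<psi> (-\<epsilon>) v) < g z} \<inter> {v. g z < g (\<psi> \<epsilon> v)})"
    by (intro open_Int open_Collect_less gcomp continuous_intros)
  obtain d4 where d4: "0 < d4" "ball z d4 \<subseteq> {v. g (\<psi> (-\<epsilon>) v) < g z} \<inter> {v. g z < g (\<psi> \<epsilon> v)}"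
    using openE[OF nb, of z] gz by auto
  define \<rho> where "\<rho> = min d4 (min d3 e1)"
  have \<rho>: "0 < \<rho>" "\<rho> \<le> d4" "\<rho> \<le> d3" "\<rho> \<le> e1" using d4 d3 e1 by (auto simp: \<rho>_def)
  define S where "S = {v \<in> ball z e1. g v = g z}"
  have ex: "\<exists>t. \<bar>t\<bar> < \<epsilon> \<and> g (\<psi> t v) = g z" if "v \<in> ball z \<rho>" for v
  proof -
    have "v \<in> ball z d4" using \<rho>(2) that by auto
    then have *: "g (\<psi> (-\<epsilon>) v) < g z" "g z < g (\<psi> \<epsilon> v)" using d4(2) by blast+
    have "continuous_on {-\<epsilon>..\<epsilon>} (\<lambda>t. g (\<psi> t v))"
      by (rule continuous_on_compose2[OF g_cont]) (auto intro!: continuous_intros)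
    with * \<epsilon>(1) obtain t where "-\<epsilon> \<le> t" "t \<le> \<epsilon>" "g (\<psi> t v) = g z"
      using IVT'[of "\<lambda>t. g (\<psi> t v)" "-\<epsilon>" "g z" \<epsilon>] by auto
    with * have "t \<noteq> \<epsilon>" "t \<noteq> -\<epsilon>" by auto
    with \<open>-\<epsilon> \<le> t\<close> \<open>t \<le> \<epsilon>\<close> \<open>g (\<psi> t v) = g z\<close> show ?thesis by (intro exI[of _ t]) auto
  qed
  define T where "T v = (SOME t. \<bar>t\<bar> < \<epsilon> \<and> g (\<psi> t v) = g z)" for v
  have T: "\<bar>T v\<bar> < \<epsilon>" "g (\<psi> (T v) v) = g z" if "v \<in> ball z \<rho>" for v
    using someI_ex[OF ex[OF that]] by (auto simp: T_def)
  have T_cont: "continuous_on (ball z \<rho>) T"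
    unfolding continuous_on_eq_continuous_at[OF open_ball] continuous_at_eps_delta
  proof (intro ballI allI impI)
    fix v and e :: real assume v: "v \<in> ball z \<rho>" and e: "0 < e"
    define a where "a = max (T v - e) (- \<epsilon>)"
    define b where "b = min (T v + e) \<epsilon>"
    have ab: "a < T v" "T v < b" "\<bar>a\<bar> < e1" "\<bar>b\<bar> < e1" using T(1)[OF v] e \<epsilon> by (auto simp: a_def b_def)
    have "g (\<psi> a v) < g z" "g z < g (\<psi> b v)"
      using mono[of a "T v" v] mono[of "T v" b v] T[OF v] ab \<epsilon> \<rho> v by (auto simp: dist_commute)
    moreover have "open ({v. g (\<psi> a v) < g z} \<inter> {v. g z < g (\<psi> b v)} \<inter> ball z \<rho>)"
      by (intro open_Int open_Collect_less gcomp continuous_intros open_ball)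
    ultimately obtain k where k: "0 < k" "ball v k \<subseteq> {v. g (\<psi> a v) < g z} \<inter> {v. g z < g (\<psi> b v)} \<inter> ball z \<rho>"
      using openE[of _ v] v by (metis (mono_tags, lifting) IntI mem_Collect_eq)
    show "\<exists>k>0. \<forall>v'. dist v' v < k \<longrightarrow> dist (T v') (T v) < e"
    proof (intro exI[of _ k] conjI allI impI k(1))
      fix v' assume "dist v' v < k"
      then have "v' \<in> ball v k" by (simp add: dist_commute)
      then have v': "g (\<psi> a v') < g z" "g z < g (\<psi> b v')" "v' \<in> ball z \<rho>" using k(2) by blast+
      note Tv' = T[OF v'(3)]
      have dv': "dist v' z < e1" using v'(3) \<rho> by (simp add: dist_commute)
      have "a < T v'"
      proof (rule ccontr)
        assume "\<not> a < T v'"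
        then have "T v' = a \<or> T v' < a" by auto
        then show False using mono[of "T v'" a v'] Tv' v' dv' ab \<epsilon> by auto
      qed
      moreover have "T v' < b"
      proof (rule ccontr)
        assume "\<not> T v' < b"
        then have "T v' = b \<or> b < T v'" by auto
        then show False using mono[of b "T v'" v'] Tv' v' dv' ab \<epsilon> by auto
      qed
      ultimately show "dist (T v') (T v) < e" by (auto simp: a_def b_def dist_real_def)
    qed
  qed
  have inball: "\<psi> (T v) v \<in> ball z e1" if "v \<in> ball z \<rho>" for v
    using d3(2)[of "T v" v] T(1)[OF that] that \<epsilon> \<rho> by (simp add: dist_commute)
  show ?thesis
  proof (rule that[of \<epsilon> \<rho> S "\<lambda>v. \<psi> (T v) v"])
    show "\<psi> t s \<notin> S" if "s \<in> S" "0 < \<bar>t\<bar>" "\<bar>t\<bar> < \<epsilon>" for s t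
    proof
      assume "\<psi> t s \<in> S"
      then have "g (\<psi> t s) = g (\<psi> 0 s)" "dist s z < e1" using that by (auto simp: S_def dist_commute)
      then show False using mono[of t 0 s] mono[of 0 t s] that \<epsilon> e1 by (cases "t > 0") auto
    qed
    show "continuous_on (ball z \<rho>) (\<lambda>v. \<psi> (T v) v)" by (intro continuous_intros T_cont)
    have "T z = 0"
    proof (rule ccontr)
      assume "T z \<noteq> 0"
      then show False using mono[of "T z" 0 z] mono[of 0 "T z" z] T[of z] \<epsilon> \<rho> e1 by (cases "T z > 0") auto
    qed
    then show "\<psi> (T z) z = z" by simp
  qed (use \<epsilon> \<rho> T inball in \<open>auto simp: S_def\<close>)
qed

lemma flow_continuous_on_time: "continuous_on A (\<lambda>t. \<psi> t x)"
  by (intro continuous_intros)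

text \<open>The trapping argument. The orbit of \<open>y\<close>, followed from a crossing of the section to its first
return to the arc \<open>k\<close> in the section, and the piece of \<open>k\<close> between these two crossings form a Jordan
curve. Orbits can leave or enter its sides only through that piece, always in the same direction. So
one side, \<open>Cp\<close>, is forward invariant, the orbit of \<open>y\<close> comes from the other one, \<open>Cm\<close>, and goes to
\<open>Cp\<close>. What has to be excluded is that both banks of the arc lie on the same side of the curve, or that
the section has branches that let orbits slip past the arc. Both follow from invariance of domain:
arc and time together parametrize an open set of the plane, and every point of the curve is in the
frontier of both sides.\<close>

lemma trap:
  assumes \<epsilon>: "0 < \<epsilon>"
    and sec: "\<And>s t. s \<in> S \<Longrightarrow> 0 < \<bar>t\<bar> \<Longrightarrow> \<bar>t\<bar> < \<epsilon> \<Longrightarrow> \<psi> t s \<notin> S"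
    and inj: "inj (\<lambda>t. \<psi> t y)" and ab: "a < b"
    and arc: "arc k" "path_image k \<subseteq> S" "pathstart k = \<psi> a y" "pathfinish k = \<psi> b y"
  obtains b' Cm Cp where "open Cm" "open Cp" "Cm \<inter> Cp = {}"
    "- ((\<lambda>t. \<psi> t y) ` {a..b} \<union> path_image k) \<subseteq> Cm \<union> Cp"
    "\<And>x t. x \<in> Cp \<Longrightarrow> 0 \<le> t \<Longrightarrow> \<psi> t x \<in> Cp"
    "\<And>t. 0 < t \<Longrightarrow> t < \<epsilon> \<Longrightarrow> \<psi> (a - t) y \<in> Cm"
    "\<And>t. 0 < t \<Longrightarrow> t < \<epsilon> \<Longrightarrow> \<psi> (b' + t) y \<in> Cp"
proof -
  have injD: "s = t" if "\<psi> s y = \<psi> t y" for s t using injD[OF inj] that by simp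
  have unique: "t = 0" if "p \<in> S" "\<psi> t p \<in> S" "\<bar>t\<bar> < \<epsilon>" for p t
    using sec[OF that(1), of t] that by (cases "t = 0") auto
  have aS: "\<psi> a y \<in> S" "\<psi> b y \<in> S"
    using arc pathstart_in_path_image[of k] pathfinish_in_path_image[of k] by auto
  (* The first return to the arc after time a.  Any visit to the section after time a comes at
     least \<epsilon> later, which makes the set of return times compact. *)
  define Z where "Z = {t \<in> {a..b}. \<psi> t y \<in> path_image k} \<inter> {a + \<epsilon>..}"
  have late: "a + \<epsilon> \<le> t" if "a < t" "\<psi> t y \<in> S" for t
  proof (rule ccontr)
    assume "\<not> a + \<epsilon> \<le> t"
    then have "t - a = 0" using that aS by (intro unique[of "\<psi> a y"]) (auto simp: flow_add[symmetric])
    with that show False by simp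
  qed
  have closedk: "closed (path_image k)" using arc(1) by (simp add: closed_arc_image)
  have "closed {t \<in> {a..b}. \<psi> t y \<in> path_image k}"
    using continuous_closed_preimage[OF flow_continuous_on_time[of "{a..b}" y] _ closedk]
    by (simp add: vimage_def Int_def)
  then have "closed Z" unfolding Z_def by (intro closed_Int) auto
  moreover have "Z = {a..b} \<inter> Z" by (auto simp: Z_def)
  ultimately have "compact Z" using compact_Int_closed[OF compact_Icc[of a b], of Z] by simp
  moreover have "b \<in> Z" using ab aS late[of b] arc pathfinish_in_path_image[of k] by (auto simp: Z_def)
  ultimately obtain b' where b': "b' \<in> Z" "\<And>t. t \<in> Z \<Longrightarrow> b' \<le> t"
    using compact_attains_inf[of Z] by auto
  have b'ab: "a < b'" "b' \<le> b" "\<psi> b' y \<in> path_image k" using b'(1) \<epsilon> by (auto simp: Z_def)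
  have first: "\<psi> t y \<notin> path_image k" if "a < t" "t < b'" for t
    using b'(2)[of t] late[of t] arc(2) that b'ab by (auto simp: Z_def)
  have [simp]: "\<psi> a y = k 0" using arc(3) by (simp add: pathstart_def)
  obtain s' where s': "s' \<in> {0..1}" "k s' = \<psi> b' y" using b'ab(3) by (auto simp: path_image_def)
  have "s' \<noteq> 0" using s' injD[of a b'] b'ab by auto
  then have s'pos: "0 < s'" using s' by simp
  define \<sigma> where "\<sigma> s = k (s' * s)" for s
  have kinj: "inj_on k {0..1}" and kcont: "continuous_on {0..1} k" using arc(1) by (auto simp: arc_def path_def)
  have s's: "s' * s \<in> {0..1}" if "s \<in> {0..1}" for s
    using s' that by (auto intro: mult_le_one)
  have \<sigma>inj: "inj_on \<sigma> {0..1}"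
  proof (rule inj_onI)
    fix u v assume uv: "u \<in> {0..1}" "v \<in> {0..1}" "\<sigma> u = \<sigma> v"
    then have "s' * u = s' * v" using inj_onD[OF kinj _ s's[OF uv(1)] s's[OF uv(2)]] unfolding \<sigma>_def by blast
    then show "u = v" using s'pos by simp
  qed
  have \<sigma>cont: "continuous_on {0..1} \<sigma>"
    unfolding \<sigma>_def by (rule continuous_on_compose2[OF kcont]) (use s's in \<open>auto intro!: continuous_intros\<close>)
  have \<sigma>k: "\<sigma> s \<in> path_image k" if "s \<in> {0..1}" for s
    using s's[OF that] by (auto simp: \<sigma>_def path_image_def)
  have \<sigma>S: "\<sigma> s \<in> S" if "s \<in> {0..1}" for s
    using \<sigma>k[OF that] arc(2) by auto
  have \<sigma>0: "\<sigma> 0 = \<psi> a y" and \<sigma>1: "\<sigma> 1 = \<psi> b' y" using s' by (auto simp: \<sigma>_def)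
  have arc\<sigma>: "arc \<sigma>" using \<sigma>inj \<sigma>cont by (simp add: arc_def path_def)
  have orb\<sigma>: "t = a \<and> s = 0 \<or> t = b' \<and> s = 1" if "a \<le> t" "t \<le> b'" "s \<in> {0..1}" "\<psi> t y = \<sigma> s" for s t
  proof -
    have "t = a \<or> t = b'" using first[of t] \<sigma>k[OF that(3)] that by force
    then show ?thesis using that \<sigma>0 \<sigma>1 \<sigma>inj by (auto simp: inj_on_def)
  qed
  (* The orbit piece from time a to time b' closed up by the part \<sigma> of the arc between its ends.
     They meet only at those ends because b' is the first return. *)
  define o' where "o' s = \<psi> ((b' - a) * s + a) y" for s
  have arco: "arc o'"
    unfolding arc_def path_def o'_def
  proof (intro conjI continuous_intros inj_onI)
    fix u v assume "\<psi> ((b' - a) * u + a) y = \<psi> ((b' - a) * v + a) y"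
    from injD[OF this] show "u = v" using b'ab by simp
  qed
  have oim: "path_image o' = (\<lambda>t. \<psi> t y) ` {a..b'}"
  proof -
    have "{a..b'} = (\<lambda>s. (b' - a) * s + a) ` {0..1}"
      using closed_segment_real_eq[of a b'] b'ab by (simp add: closed_segment_eq_real_ivl)
    then show ?thesis unfolding path_image_def o'_def by (simp only: image_image)
  qed
  define J where "J = (\<lambda>t. \<psi> t y) ` {a..b'} \<union> \<sigma> ` {0..1}"
  define c where "c = o' +++ reversepath \<sigma>"
  have ends: "pathstart o' = \<psi> a y" "pathfinish o' = \<psi> b' y" "pathstart \<sigma> = \<psi> a y" "pathfinish \<sigma> = \<psi> b' y"
    using \<sigma>0 \<sigma>1 by (auto simp: o'_def pathstart_def pathfinish_def)
  have c_simple: "simple_path c"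
    unfolding c_def
  proof (rule simple_path_join_loop)
    show "path_image o' \<inter> path_image (reversepath \<sigma>) \<subseteq> {pathstart o', pathstart (reversepath \<sigma>)}"
      using orb\<sigma> \<sigma>0 \<sigma>1 unfolding path_image_reversepath pathstart_reversepath ends oim by (force simp: path_image_def)
  qed (simp_all add: arco arc\<sigma> arc_reversepath ends)
  have c_loop: "pathfinish c = pathstart c" by (simp add: c_def ends)
  have c_im: "path_image c = J"
    by (simp add: c_def path_image_join ends oim J_def) (simp add: path_image_def)
  note Jordan = Jordan_inside_outside[OF c_simple c_loop, unfolded c_im]
  have Jsub: "J \<subseteq> (\<lambda>t. \<psi> t y) ` {a..b} \<union> path_image k"
    using \<sigma>k b'ab by (auto simp: J_def)
  (* The tubes just before and just after \<sigma>.  The orbit arrives at \<psi> a y through Bm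
     and leaves \<psi> b' y through Bp, so Bm includes the end s = 0 of \<sigma> and Bp the end s = 1. *)
  define Bm where "Bm = (\<lambda>(s, t). \<psi> t (\<sigma> s)) ` ({0..<1} \<times> {-\<epsilon><..<0})"
  define Bp where "Bp = (\<lambda>(s, t). \<psi> t (\<sigma> s)) ` ({0<..1} \<times> {0<..<\<epsilon>})"
  have ccont: "continuous_on (X \<times> Y) (\<lambda>(s, t). \<psi> t (\<sigma> s))" if "X \<subseteq> {0..1}" for X Y
    unfolding case_prod_beta
    by (intro continuous_intros continuous_on_compose2[OF \<sigma>cont]) (use that in auto)
  have conn: "connected Bm" "connected Bp"
    unfolding Bm_def Bp_def by (intro connected_continuous_image ccont connected_Times; auto)+
  have "Bm \<inter> J = {}"
  proof -
    have False if st: "0 \<le> s" "s < 1" "-\<epsilon> < t" "t < 0" "\<psi> t (\<sigma> s) \<in> J" for s t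
      using st(5) unfolding J_def
    proof
      assume "\<psi> t (\<sigma> s) \<in> \<sigma> ` {0..1}"
      then show False using unique[of "\<sigma> s" t] \<sigma>S st by force
    next
      assume "\<psi> t (\<sigma> s) \<in> (\<lambda>t. \<psi> t y) ` {a..b'}"
      then obtain u where u: "a \<le> u" "u \<le> b'" "\<psi> t (\<sigma> s) = \<psi> u y" by auto
      then have e: "\<sigma> s = \<psi> (u - t) y" by (metis flow_add flow_inverse(2) diff_conv_add_uminus add.commute)
      show False
      proof (cases "u - t \<le> b'")
        case True
        then show False using orb\<sigma>[of "u - t" s] u e st by auto
      next
        case False
        then have "u - t - b' = 0"
          using u st \<sigma>S[of s] \<sigma>S[of 1] e \<sigma>1
          by (intro unique[of "\<psi> b' y"]) (auto simp: flow_add[symmetric])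
        then show False using False by simp
      qed
    qed
    then show ?thesis by (auto simp: Bm_def)
  qed
  moreover have "Bp \<inter> J = {}"
  proof -
    have False if st: "0 < s" "s \<le> 1" "0 < t" "t < \<epsilon>" "\<psi> t (\<sigma> s) \<in> J" for s t
      using st(5) unfolding J_def
    proof
      assume "\<psi> t (\<sigma> s) \<in> \<sigma> ` {0..1}"
      then show False using unique[of "\<sigma> s" t] \<sigma>S st by force
    next
      assume "\<psi> t (\<sigma> s) \<in> (\<lambda>t. \<psi> t y) ` {a..b'}"
      then obtain u where u: "a \<le> u" "u \<le> b'" "\<psi> t (\<sigma> s) = \<psi> u y" by auto
      then have e: "\<sigma> s = \<psi> (u - t) y" by (metis flow_add flow_inverse(2) diff_conv_add_uminus add.commute)
      show False
      proof (cases "a \<le> u - t")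
        case True
        then show False using orb\<sigma>[of "u - t" s] u e st by auto
      next
        case False
        then have "u - t - a = 0"
          using u st \<sigma>S[of s] aS e
          by (intro unique[of "\<psi> a y"]) (simp_all only: flow_add[symmetric], auto)
        then show False using False by simp
      qed
    qed
    then show ?thesis by (auto simp: Bp_def)
  qed
  ultimately have BJ: "Bm \<subseteq> - J" "Bp \<subseteq> - J" by auto
  (* The two tubes and \<sigma> together contain a neighbourhood of an interior point of \<sigma>.  The time
     range is halved since the difference of two times has to stay below \<epsilon>. *)
  define R where "R = box (Complex 0 (-\<epsilon>/2)) (Complex 1 (\<epsilon>/2))"
  have R: "w \<in> R \<longleftrightarrow> 0 < Re w \<and> Re w < 1 \<and> -\<epsilon>/2 < Im w \<and> Im w < \<epsilon>/2" for w
    by (auto simp: R_def in_box_complex_iff)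
  define O' where "O' = (\<lambda>w. \<psi> (Im w) (\<sigma> (Re w))) ` R"
  have openO: "open O'"
    unfolding O'_def
  proof (rule invariance_of_domain)
    show "continuous_on R (\<lambda>w. \<psi> (Im w) (\<sigma> (Re w)))"
      by (intro continuous_intros continuous_on_compose2[OF \<sigma>cont]) (auto simp: R)
    show "open R" unfolding R_def by (rule open_box)
    show "inj_on (\<lambda>w. \<psi> (Im w) (\<sigma> (Re w))) R"
    proof (rule inj_onI)
      fix v w assume vw: "v \<in> R" "w \<in> R" "\<psi> (Im v) (\<sigma> (Re v)) = \<psi> (Im w) (\<sigma> (Re w))"
      then have "\<sigma> (Re v) = \<psi> (Im w - Im v) (\<sigma> (Re w))"
        by (metis flow_add flow_inverse(2) diff_conv_add_uminus add.commute)
      moreover from this have "Im w - Im v = 0"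
        using vw(1,2) \<sigma>S[of "Re v"] \<sigma>S[of "Re w"] by (intro unique[of "\<sigma> (Re w)"]) (auto simp: R)
      ultimately show "v = w" using \<sigma>inj vw(1,2) by (auto simp: R inj_on_def complex_eq_iff)
    qed
  qed
  have Osub: "O' \<subseteq> Bm \<union> Bp \<union> J"
  proof
    fix p assume "p \<in> O'"
    then obtain w where w: "w \<in> R" "p = \<psi> (Im w) (\<sigma> (Re w))" by (auto simp: O'_def)
    consider "Im w < 0" | "Im w = 0" | "Im w > 0" by linarith
    then show "p \<in> Bm \<union> Bp \<union> J"
    proof cases
      case 1
      then have "p \<in> Bm" unfolding Bm_def using w by (auto simp: R intro!: image_eqI[of _ _ "(Re w, Im w)"])
      then show ?thesis by simp
    next
      case 2
      then show ?thesis using w by (auto simp: R J_def)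
    next
      case 3
      then have "p \<in> Bp" unfolding Bp_def using w by (auto simp: R intro!: image_eqI[of _ _ "(Re w, Im w)"])
      then show ?thesis by simp
    qed
  qed
  define q where "q = \<sigma> (1/2)"
  have qO: "q \<in> O'" unfolding O'_def q_def
    by (rule image_eqI[of _ _ "Complex (1/2) 0"]) (use \<epsilon> in \<open>auto simp: R\<close>)
  have qJ: "q \<in> J" by (auto simp: q_def J_def)
  have meets: "O' \<inter> inside J \<noteq> {}" "O' \<inter> outside J \<noteq> {}"
  proof -
    have "q \<in> closure (inside J)" "q \<in> closure (outside J)"
      using Jordan qJ unfolding frontier_def by blast+
    then show "O' \<inter> inside J \<noteq> {}" "O' \<inter> outside J \<noteq> {}"
      using open_Int_closure_eq_empty[OF openO] qO by blast+
  qed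
  have inout: "inside J \<union> outside J = - J" "inside J \<inter> outside J = {}" "open (inside J)" "open (outside J)"
    using Jordan by auto
  have side: "B \<subseteq> inside J \<or> B \<subseteq> outside J" if "connected B" "B \<subseteq> - J" for B
    using connectedD[OF that(1) inout(3,4)] inout that(2) by blast
  obtain Cm Cp where C: "open Cm" "open Cp" "Cm \<inter> Cp = {}" "Cm \<union> Cp = - J" "Bm \<subseteq> Cm" "Bp \<subseteq> Cp"
  proof -
    have *: "\<not> (Bm \<subseteq> inside J \<and> Bp \<subseteq> inside J)" "\<not> (Bm \<subseteq> outside J \<and> Bp \<subseteq> outside J)"
      using meets Osub inout by blast+
    show ?thesis
    proof (cases "Bm \<subseteq> inside J")
      case True
      then have "Bp \<subseteq> outside J" using * side[OF conn(2) BJ(2)] by blast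
      with True inout show ?thesis by (intro that[of "inside J" "outside J"]) auto
    next
      case False
      then have "Bm \<subseteq> outside J" using side[OF conn(1) BJ(1)] by blast
      moreover from this have "Bp \<subseteq> inside J" using * side[OF conn(2) BJ(2)] by blast
      moreover have "outside J \<union> inside J = - J" "outside J \<inter> inside J = {}" using inout by blast+
      ultimately show ?thesis using inout(3,4) that[of "outside J" "inside J"] by blast
    qed
  qed
  have clos: "x \<in> J" if "x \<in> closure Cp" "x \<notin> Cp" for x
    using open_Int_closure_eq_empty[OF C(1), of Cp] C(3,4) that by auto
  have invariant: "\<psi> t x \<in> Cp" if x: "x \<in> Cp" "0 \<le> t" for x t
  proof (rule ccontr)
    assume out: "\<psi> t x \<notin> Cp"
    define X where "X = {s \<in> {0..t}. \<psi> s x \<in> - Cp}"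
    have "closed X"
      unfolding X_def
      using continuous_closed_preimage[OF flow_continuous_on_time[of "{0..t}" x], of "- Cp"] C(2)
      by (simp add: vimage_def Int_def closed_Compl)
    then have "compact X"
      using compact_Int_closed[OF compact_Icc[of 0 t]] by (metis (no_types, lifting) X_def inf.absorb_iff2 mem_Collect_eq subsetI)
    moreover have "t \<in> X" using out x by (auto simp: X_def)
    ultimately obtain m where m: "m \<in> X" "\<And>s. s \<in> X \<Longrightarrow> m \<le> s"
      using compact_attains_inf[of X] by auto
    have mout: "\<psi> m x \<notin> Cp" and mt: "0 \<le> m" "m \<le> t" using m(1) by (auto simp: X_def)
    have m0: "0 < m" using mout x(1) mt by (cases "m = 0") auto
    have before: "\<psi> s x \<in> Cp" if "0 \<le> s" "s < m" for s
      using m(2)[of s] that mt by (auto simp: X_def)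
    have "\<psi> m x \<in> closure Cp"
    proof (rule Lim_in_closed_set[OF closed_closure])
      show "((\<lambda>s. \<psi> s x) \<longlongrightarrow> \<psi> m x) (at_left m)"
        by (intro flow_tendsto tendsto_intros)
      show "\<forall>\<^sub>F s in at_left m. \<psi> s x \<in> closure Cp"
        unfolding eventually_at_left[OF m0]
        by (intro exI[of _ 0]) (use m0 before closure_subset[of Cp] in auto)
    qed (simp)
    then have mJ: "\<psi> m x \<in> J" using clos mout by simp
    have no\<sigma>: False if s: "0 \<le> s" "s < 1" "\<psi> m x = \<sigma> s" for s
    proof -
      define e where "e = min m \<epsilon> / 2"
      have e: "0 < e" "e < m" "e < \<epsilon>" using m0 \<epsilon> by (auto simp: e_def)
      have "\<psi> (- e) (\<sigma> s) \<in> Bm"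
        unfolding Bm_def by (rule image_eqI[of _ _ "(s, -e)"]) (use s e in auto)
      moreover have "\<psi> (- e) (\<sigma> s) = \<psi> (m - e) x"
        unfolding s(3)[symmetric] by (simp add: flow_add[symmetric])
      ultimately show False using C before[of "m - e"] e by auto
    qed
    have noo: False if u: "a < u" "u \<le> b'" "\<psi> m x = \<psi> u y" for u
    proof -
      define e where "e = min m (u - a) / 2"
      have e: "0 < e" "e < m" "e < u - a" using m0 u by (auto simp: e_def)
      have "\<psi> (m - e) x = \<psi> (-e) (\<psi> m x)" by (simp add: flow_add[symmetric])
      also have "\<dots> = \<psi> (u - e) y" unfolding u(3) by (simp add: flow_add[symmetric])
      also have "\<dots> \<in> J" using e u by (auto simp: J_def)
      finally show False using before[of "m - e"] e C(4) by auto
    qed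
    from mJ consider u where "a \<le> u" "u \<le> b'" "\<psi> m x = \<psi> u y" | s where "0 \<le> s" "s \<le> 1" "\<psi> m x = \<sigma> s"
      by (auto simp: J_def)
    then show False
    proof cases
      case 1
      then show False using noo[of u] no\<sigma>[of 0] \<sigma>0 by (cases "u = a") auto
    next
      case 2
      then show False using no\<sigma>[of s] noo[of b'] \<sigma>1 b'ab by (cases "s = 1") auto
    qed
  qed
  show ?thesis
  proof (rule that[of Cm Cp b'])
    show "\<psi> (a - t) y \<in> Cm" if "0 < t" "t < \<epsilon>" for t
    proof -
      have "\<psi> (a - t) y = \<psi> (- t) (\<sigma> 0)" unfolding \<sigma>0 flow_add[symmetric] by simp
      also have "\<dots> \<in> Bm" unfolding Bm_def by (rule image_eqI[of _ _ "(0, -t)"]) (use that in auto)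
      finally show ?thesis using C by auto
    qed
    show "\<psi> (b' + t) y \<in> Cp" if "0 < t" "t < \<epsilon>" for t
    proof -
      have "\<psi> (b' + t) y = \<psi> t (\<sigma> 1)" unfolding \<sigma>1 flow_add[symmetric] by (simp add: add.commute)
      also have "\<dots> \<in> Bp" unfolding Bp_def by (rule image_eqI[of _ _ "(1, t)"]) (use that in auto)
      finally show ?thesis using C by auto
    qed
    show "- ((\<lambda>t. \<psi> t y) ` {a..b} \<union> path_image k) \<subseteq> Cm \<union> Cp" using C Jsub by auto
  qed (use b'ab C invariant in auto)
qed

lemma omega_limit_invariant:
  assumes "w \<in> omega_limit (\<lambda>t. \<psi> t x)"
  shows "\<psi> s w \<in> omega_limit (\<lambda>t. \<psi> t x)"
proof -
  obtain t where t: "filterlim t at_top sequentially" "(\<lambda>n. \<psi> (t n) x) \<longlonglongrightarrow> w"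
    using assms by (auto simp: omega_limit_def)
  have "(\<lambda>n. \<psi> (s + t n) x) \<longlonglongrightarrow> \<psi> s w"
    unfolding flow_add by (intro flow_tendsto tendsto_const t)
  moreover have "filterlim (\<lambda>n. s + t n) at_top sequentially"
    by (intro filterlim_tendsto_add_at_top[OF tendsto_const] t)
  ultimately show ?thesis by (auto simp: omega_limit_def)
qed

lemma periodic_multiple:
  assumes "\<psi> T y = y"
  shows "\<psi> (of_int n * T) y = y"
proof -
  have pos: "\<psi> (of_nat m * T) y = y" for m
    by (induction m) (use assms in \<open>simp_all add: distrib_right flow_add\<close>)
  have "\<psi> (- (of_nat m * T)) y = y" for m
    using flow_inverse(2)[of "of_nat m * T" y] by (simp add: pos)
  with pos show ?thesis by (cases n) (auto simp del: of_nat_Suc)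
qed

lemma periodic_range:
  assumes "\<psi> T y = y" "0 < T"
  shows "range (\<lambda>t. \<psi> t y) = (\<lambda>t. \<psi> t y) ` {0..T}"
proof -
  have "\<psi> t y \<in> (\<lambda>t. \<psi> t y) ` {0..T}" for t
  proof -
    define n where "n = \<lfloor>t / T\<rfloor>"
    have "of_int n \<le> t / T" "t / T < of_int n + 1" by (auto simp: n_def)
    then have "0 \<le> t - of_int n * T" "t - of_int n * T \<le> T" using assms(2) by (auto simp: field_simps)
    moreover have "\<psi> t y = \<psi> (t - of_int n * T) y"
      using flow_add[of "t - of_int n * T" "of_int n * T" y] periodic_multiple[OF assms(1), of n] by simp
    ultimately show ?thesis by auto
  qed
  then show ?thesis by auto
qed

lemma periodic_orbit_compact:
  assumes "\<psi> T y = y" "0 < T"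
  shows "compact (range (\<lambda>t. \<psi> t y))"
  unfolding periodic_range[OF assms] by (intro compact_continuous_image continuous_intros compact_Icc)

lemma not_inj_periodic:
  assumes "\<not> inj (\<lambda>t. \<psi> t y)"
  obtains T where "0 < T" "\<psi> T y = y"
proof -
  obtain s t where st: "\<psi> s y = \<psi> t y" "s < t"
    using assms unfolding inj_def by (metis linorder_neqE)
  have "\<psi> (t - s) y = \<psi> (- s) (\<psi> s y)" unfolding st(1) by (simp add: flow_add[symmetric])
  with st(2) that[of "t - s"] show ?thesis by simp
qed

text \<open>A local section need not be known to be an arc. But the retraction \<open>r\<close> maps the segment between two
points of an orbit near \<open>z\<close> to a path in the section, and such a path contains an arc with the same
ends.\<close>

lemma crossing_arc:
  assumes r: "continuous_on (ball z \<rho>) r"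
    "\<And>v. v \<in> ball z \<rho> \<Longrightarrow> \<exists>t. \<bar>t\<bar> < \<epsilon> \<and> r v = \<psi> t v"
    and t: "\<psi> t1 y \<in> ball z \<rho>'" "\<psi> t2 y \<in> ball z \<rho>'" "\<rho>' \<le> \<rho>" "t1 + 2 * \<epsilon> \<le> t2"
    and inj: "inj (\<lambda>t. \<psi> t y)"
  obtains a b k where "a < b" "\<bar>a - t1\<bar> < \<epsilon>" "\<bar>b - t2\<bar> < \<epsilon>"
    "arc k" "path_image k \<subseteq> r ` ball z \<rho>'" "pathstart k = \<psi> a y" "pathfinish k = \<psi> b y"
proof -
  have sub: "ball z \<rho>' \<subseteq> ball z \<rho>" using t(3) by (rule subset_ball)
  obtain s1 s2 where s: "\<bar>s1\<bar> < \<epsilon>" "r (\<psi> t1 y) = \<psi> s1 (\<psi> t1 y)" "\<bar>s2\<bar> < \<epsilon>" "r (\<psi> t2 y) = \<psi> s2 (\<psi> t2 y)"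
    using r(2) t sub by blast
  define a b where "a = s1 + t1" and "b = s2 + t2"
  have ab: "a < b" using s t(4) by (auto simp: a_def b_def abs_less_iff)
  define p where "p = r \<circ> linepath (\<psi> t1 y) (\<psi> t2 y)"
  have seg: "closed_segment (\<psi> t1 y) (\<psi> t2 y) \<subseteq> ball z \<rho>'"
    by (rule closed_segment_subset) (use t in auto)
  have "path p" unfolding p_def
    by (intro path_continuous_image) (use seg sub r(1) in \<open>auto intro: continuous_on_subset\<close>)
  moreover have pse: "pathstart p = \<psi> a y" "pathfinish p = \<psi> b y"
    using s by (simp_all add: p_def pathstart_compose pathfinish_compose a_def b_def flow_add)
  moreover have "\<psi> a y \<noteq> \<psi> b y" using injD[OF inj, of a b] ab by auto
  ultimately obtain k where k: "arc k" "path_image k \<subseteq> path_image p" "pathstart k = \<psi> a y" "pathfinish k = \<psi> b y"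
    using path_contains_arc[of p "\<psi> a y" "\<psi> b y"] by blast
  have "path_image p \<subseteq> r ` ball z \<rho>'" using seg by (auto simp: p_def path_image_compose)
  with k ab s that[of a b k] show ?thesis by (auto simp: a_def b_def)
qed

text \<open>Recurrence of the orbit of \<open>y\<close> near a point \<open>z\<close> that is not at rest produces two crossings
of a section at \<open>z\<close>. If the orbit is not periodic, these give a trap. But then the orbit of \<open>x\<close>, which
comes close to every point of the orbit of \<open>y\<close> arbitrarily late, would enter \<open>Cp\<close> and visit \<open>Cm\<close>
later.\<close>

lemma recurrence_near_moving_point_periodic:
  assumes y: "y \<in> omega_limit (\<lambda>t. \<psi> t x)"
    and z: "z \<in> omega_limit (\<lambda>t. \<psi> t y) \<union> alpha_limit (\<lambda>t. \<psi> t y)"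
    and h: "\<psi> h z \<noteq> z"
  obtains T where "0 < T" "\<psi> T y = y"
proof (cases "inj (\<lambda>t. \<psi> t y)")
  case False
  then show ?thesis using not_inj_periodic that by blast
next
  case inj: True
  obtain S r and \<epsilon> \<rho> :: real where sec: "0 < \<epsilon>" "0 < \<rho>"
    "\<And>s t. s \<in> S \<Longrightarrow> 0 < \<bar>t\<bar> \<Longrightarrow> \<bar>t\<bar> < \<epsilon> \<Longrightarrow> \<psi> t s \<notin> S"
    "continuous_on (ball z \<rho>) r" "r z = z"
    "\<And>v. v \<in> ball z \<rho> \<Longrightarrow> r v \<in> S"
    "\<And>v. v \<in> ball z \<rho> \<Longrightarrow> \<exists>t. \<bar>t\<bar> < \<epsilon> \<and> r v = \<psi> t v"
    by (rule local_section[OF h]) (rule that; assumption)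
  have zb: "z \<in> ball z \<rho>" using sec(2) by simp
  obtain t1 t2 where t: "\<psi> t1 y \<in> ball z \<rho>" "\<psi> t2 y \<in> ball z \<rho>" "t1 + 2 * \<epsilon> \<le> t2"
  proof (cases "z \<in> omega_limit (\<lambda>t. \<psi> t y)")
    case True
    from omega_limit_visits[OF this open_ball zb, of 0] obtain t1 where t1: "\<psi> t1 y \<in> ball z \<rho>" by blast
    from omega_limit_visits[OF True open_ball zb, of "t1 + 2 * \<epsilon>"] t1 that show ?thesis by blast
  next
    case False
    then have "z \<in> alpha_limit (\<lambda>t. \<psi> t y)" using z by simp
    note al = alpha_limit_visits[OF this open_ball zb]
    from al[of 0] obtain t2 where t2: "\<psi> t2 y \<in> ball z \<rho>" by blast
    from al[of "t2 - 2 * \<epsilon>"] obtain t1 where "t1 \<le> t2 - 2 * \<epsilon>" "\<psi> t1 y \<in> ball z \<rho>" by blast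
    with t2 that[of t1 t2] show ?thesis by simp
  qed
  obtain a b k where k: "a < b"
    "arc k" "path_image k \<subseteq> r ` ball z \<rho>" "pathstart k = \<psi> a y" "pathfinish k = \<psi> b y"
    by (rule crossing_arc[OF sec(4,7) t(1,2) order_refl t(3) inj]; (assumption | (rule that; assumption)))
  have kS: "path_image k \<subseteq> S" using k(3) sec(6) by auto
  obtain b' Cm Cp where C': "open Cm" "open Cp" "Cm \<inter> Cp = {}"
    "- ((\<lambda>t. \<psi> t y) ` {a..b} \<union> path_image k) \<subseteq> Cm \<union> Cp"
    "\<And>x t. x \<in> Cp \<Longrightarrow> 0 \<le> t \<Longrightarrow> \<psi> t x \<in> Cp"
    "\<And>t. 0 < t \<Longrightarrow> t < \<epsilon> \<Longrightarrow> \<psi> (a - t) y \<in> Cm"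
    "\<And>t. 0 < t \<Longrightarrow> t < \<epsilon> \<Longrightarrow> \<psi> (b' + t) y \<in> Cp"
    by (rule trap[OF sec(1,3) inj k(1,2) kS k(4,5)]; (assumption | (rule that; assumption)))
  have C: "open Cm" "open Cp" "Cm \<inter> Cp = {}"
    "\<And>x t. x \<in> Cp \<Longrightarrow> 0 \<le> t \<Longrightarrow> \<psi> t x \<in> Cp"
    "\<psi> (a - \<epsilon>/2) y \<in> Cm" "\<psi> (b' + \<epsilon>/2) y \<in> Cp"
    using C' sec(1) by simp_all
  from omega_limit_visits[OF omega_limit_invariant[OF y] C(2,6)]
  obtain s where s: "\<psi> s x \<in> Cp" by blast
  from omega_limit_visits[OF omega_limit_invariant[OF y] C(1,5), of s]
  obtain t where t: "s \<le> t" "\<psi> t x \<in> Cm" by blast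
  have "\<psi> t x \<in> Cp" using C(4)[OF s, of "t - s"] t(1) by (simp add: flow_add[symmetric])
  with t C(3) show ?thesis by blast
qed

text \<open>If the limit set had a point \<open>w\<close> off the periodic orbit \<open>\<Gamma>\<close>, then \<open>x\<close> and \<open>w\<close> could be joined
by a path off \<open>\<Gamma>\<close>. When the orbit of \<open>x\<close> is near \<open>y\<close>, it follows \<open>\<Gamma>\<close> for a whole period and
crosses a section at \<open>y\<close> twice, and the resulting trap has its curve so close to \<open>\<Gamma>\<close> that the path
avoids it. But \<open>x\<close>, being in the past of the trap, is in \<open>Cm\<close>, and \<open>w\<close>, which the orbit of \<open>x\<close>
approaches after entering the trap, is not.\<close>

lemma periodic_orbit_is_whole_limit_set:
  assumes y: "y \<in> omega_limit (\<lambda>t. \<psi> t x)"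
    and T: "0 < T" "\<psi> T y = y" and h: "\<psi> h y \<noteq> y"
  shows "omega_limit (\<lambda>t. \<psi> t x) = range (\<lambda>t. \<psi> t y)"
proof (rule ccontr)
  define \<Gamma> where "\<Gamma> = range (\<lambda>t. \<psi> t y)"
  assume "omega_limit (\<lambda>t. \<psi> t x) \<noteq> range (\<lambda>t. \<psi> t y)"
  moreover have "\<Gamma> \<subseteq> omega_limit (\<lambda>t. \<psi> t x)" using omega_limit_invariant[OF y] by (auto simp: \<Gamma>_def)
  ultimately obtain w where w: "w \<in> omega_limit (\<lambda>t. \<psi> t x)" "w \<notin> \<Gamma>" by (auto simp: \<Gamma>_def)
  have \<Gamma>: "compact \<Gamma>" unfolding \<Gamma>_def by (rule periodic_orbit_compact[OF T(2,1)])
  have \<Gamma>inv: "\<psi> s p \<in> \<Gamma>" if "p \<in> \<Gamma>" for s p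
    using that by (auto simp: \<Gamma>_def flow_add[symmetric])
  have off: "\<psi> t x \<notin> \<Gamma>" for t
  proof
    assume "\<psi> t x \<in> \<Gamma>"
    then have "\<psi> s x \<in> \<Gamma>" for s
      using \<Gamma>inv[of "\<psi> t x" "s - t"] by (simp add: flow_add[symmetric])
    then have "omega_limit (\<lambda>t. \<psi> t x) \<subseteq> \<Gamma>"
      by (intro omega_limit_closed_subset compact_imp_closed[OF \<Gamma>]) auto
    with w show False by auto
  qed
  have inj: "inj (\<lambda>t. \<psi> t x)"
  proof (rule ccontr)
    assume "\<not> inj (\<lambda>t. \<psi> t x)"
    then obtain T' where T': "0 < T'" "\<psi> T' x = x" using not_inj_periodic by blast
    have "omega_limit (\<lambda>t. \<psi> t x) \<subseteq> range (\<lambda>t. \<psi> t x)"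
      by (intro omega_limit_closed_subset compact_imp_closed[OF periodic_orbit_compact[OF T'(2,1)]] subset_refl)
    with y obtain s where "y = \<psi> s x" by blast
    then have "\<psi> s x \<in> \<Gamma>" by (auto simp: \<Gamma>_def intro!: image_eqI[of _ _ 0])
    with off show False by blast
  qed
  (* The forward orbit of x together with its limit point w is connected and avoids \<Gamma>, hence
     some path l from x to w stays at a positive distance \<eta> from \<Gamma>. *)
  have "connected (insert w ((\<lambda>t. \<psi> t x) ` {0..}))"
  proof (rule connected_intermediate_closure)
    show "connected ((\<lambda>t. \<psi> t x) ` {0..})" by (intro connected_continuous_image continuous_intros) auto
    have "w \<in> closure ((\<lambda>t. \<psi> t x) ` {0..})"
      unfolding closure_iff_nhds_not_empty
    proof (intro allI impI)
      fix A V assume "V \<subseteq> A" "w \<in> V" "open V"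
      then show "(\<lambda>t. \<psi> t x) ` {0..} \<inter> A \<noteq> {}"
        using omega_limit_visits[OF w(1) \<open>open V\<close> \<open>w \<in> V\<close>, of 0] by (metis IntI atLeast_iff empty_iff imageI subsetD)
    qed
    then show "insert w ((\<lambda>t. \<psi> t x) ` {0..}) \<subseteq> closure ((\<lambda>t. \<psi> t x) ` {0..})"
      by (simp add: closure_subset)
  qed auto
  moreover have "insert w ((\<lambda>t. \<psi> t x) ` {0..}) \<subseteq> - \<Gamma>" using w off by auto
  moreover have "x \<in> insert w ((\<lambda>t. \<psi> t x) ` {0..})" by (rule insertI2, rule image_eqI[of _ _ 0]) auto
  ultimately have "connected_component (- \<Gamma>) x w"
    unfolding connected_component_def by blast
  then have "path_component (- \<Gamma>) x w"
    using open_path_connected_component[of "- \<Gamma>" x] compact_imp_closed[OF \<Gamma>] by (simp add: open_Compl)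
  then obtain l where l: "path l" "path_image l \<subseteq> - \<Gamma>" "pathstart l = x" "pathfinish l = w"
    by (auto simp: path_component_def)
  obtain \<eta> where \<eta>: "0 < \<eta>" "\<And>p q. p \<in> path_image l \<Longrightarrow> q \<in> \<Gamma> \<Longrightarrow> \<eta> \<le> dist p q"
    using separate_compact_closed[OF compact_path_image[OF l(1)] compact_imp_closed[OF \<Gamma>]] l(2) by blast
  obtain S r and \<epsilon> \<rho> :: real where sec: "0 < \<epsilon>" "0 < \<rho>"
    "\<And>s t. s \<in> S \<Longrightarrow> 0 < \<bar>t\<bar> \<Longrightarrow> \<bar>t\<bar> < \<epsilon> \<Longrightarrow> \<psi> t s \<notin> S"
    "continuous_on (ball y \<rho>) r" "r y = y"
    "\<And>v. v \<in> ball y \<rho> \<Longrightarrow> r v \<in> S"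
    "\<And>v. v \<in> ball y \<rho> \<Longrightarrow> \<exists>t. \<bar>t\<bar> < \<epsilon> \<and> r v = \<psi> t v"
    by (rule local_section[OF h]) (rule that; assumption)
  (* A multiple P of the period that leaves room for two separate crossings. *)
  obtain n :: nat where n: "2 * \<epsilon> / T \<le> of_nat n" using real_arch_simple by blast
  define P where "P = of_nat n * T"
  have P: "2 * \<epsilon> \<le> P" using n T(1) by (simp add: P_def field_simps)
  have Py: "\<psi> P y = y" using periodic_multiple[OF T(2), of "int n"] by (simp add: P_def)
  have "isCont r y" using sec(2,4) by (simp add: continuous_on_eq_continuous_at)
  then obtain \<rho>1 where \<rho>1: "0 < \<rho>1" "\<And>v. dist v y < \<rho>1 \<Longrightarrow> dist (r v) y < \<eta>"
    using \<eta>(1) sec(5) unfolding continuous_at_eps_delta by metis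
  define \<rho>' where "\<rho>' = min \<rho> \<rho>1"
  have \<rho>': "0 < \<rho>'" "\<rho>' \<le> \<rho>" "\<rho>' \<le> \<rho>1" using sec(2) \<rho>1(1) by (auto simp: \<rho>'_def)
  obtain d1 where d1: "0 < d1" "\<And>s v. -\<epsilon> \<le> s \<Longrightarrow> s \<le> P + \<epsilon> \<Longrightarrow> dist v y < d1 \<Longrightarrow> dist (\<psi> s v) (\<psi> s y) < \<eta>"
    using flow_near_compact[OF \<eta>(1), of "-\<epsilon>" "P + \<epsilon>" y] by blast
  obtain d2 where d2: "0 < d2" "\<And>s v. \<bar>s - P\<bar> < d2 \<Longrightarrow> dist v y < d2 \<Longrightarrow> dist (\<psi> s v) (\<psi> P y) < \<rho>'"
    using flow_near[OF \<rho>'(1), of P y] by blast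
  define d where "d = min (min d1 d2) \<rho>'"
  have d: "0 < d" "d \<le> d1" "d \<le> d2" "d \<le> \<rho>'" using d1 d2 \<rho>' by (auto simp: d_def)
  from omega_limit_visits[OF y open_ball, of y d \<epsilon>] d(1)
  obtain t1 where t1: "\<epsilon> \<le> t1" "dist (\<psi> t1 x) y < d" by (auto simp: dist_commute)
  have q1: "\<psi> t1 x \<in> ball y \<rho>'" using t1 d by (simp add: dist_commute)
  have q2: "\<psi> (P + t1) x \<in> ball y \<rho>'"
    using d2(2)[of P "\<psi> t1 x"] d2(1) t1 d Py by (simp add: dist_commute flow_add)
  have q3: "t1 + 2 * \<epsilon> \<le> P + t1" using P by simp
  obtain a b k where k: "a < b" "\<bar>a - t1\<bar> < \<epsilon>" "\<bar>b - (P + t1)\<bar> < \<epsilon>"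
    "arc k" "path_image k \<subseteq> r ` ball y \<rho>'" "pathstart k = \<psi> a x" "pathfinish k = \<psi> b x"
    by (rule crossing_arc[OF sec(4,7) q1 q2 \<rho>'(2) q3 inj]; (assumption | (rule that; assumption)))
  have kS: "path_image k \<subseteq> S" using k(5) sec(6) \<rho>' by auto
  obtain b' Cm Cp where C: "open Cm" "open Cp" "Cm \<inter> Cp = {}"
    "- ((\<lambda>t. \<psi> t x) ` {a..b} \<union> path_image k) \<subseteq> Cm \<union> Cp"
    "\<And>x t. x \<in> Cp \<Longrightarrow> 0 \<le> t \<Longrightarrow> \<psi> t x \<in> Cp"
    "\<And>t. 0 < t \<Longrightarrow> t < \<epsilon> \<Longrightarrow> \<psi> (a - t) x \<in> Cm"
    "\<And>t. 0 < t \<Longrightarrow> t < \<epsilon> \<Longrightarrow> \<psi> (b' + t) x \<in> Cp"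
    by (rule trap[OF sec(1,3) inj k(1,4) kS k(6,7)]; (assumption | (rule that; assumption)))
  have Cpb: "\<psi> (b' + \<epsilon>/2) x \<in> Cp" using C(7)[of "\<epsilon>/2"] sec(1) by simp
  have "path_image l \<inter> ((\<lambda>t. \<psi> t x) ` {a..b} \<union> path_image k) = {}"
  proof -
    have "\<psi> t x \<notin> path_image l" if "a \<le> t" "t \<le> b" for t
    proof
      assume "\<psi> t x \<in> path_image l"
      then have "\<eta> \<le> dist (\<psi> t x) (\<psi> (t - t1) y)" using \<eta>(2) by (auto simp: \<Gamma>_def)
      moreover have "dist (\<psi> (t - t1) (\<psi> t1 x)) (\<psi> (t - t1) y) < \<eta>"
        by (rule d1(2)) (use that k(2,3) t1 d in \<open>auto simp: abs_less_iff\<close>)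
      ultimately show False by (simp add: flow_add[symmetric])
    qed
    moreover have "q \<notin> path_image l" if "q \<in> path_image k" for q
    proof
      assume "q \<in> path_image l"
      moreover have "y \<in> \<Gamma>" by (auto simp: \<Gamma>_def intro!: image_eqI[of _ _ 0])
      ultimately have "\<eta> \<le> dist q y" using \<eta>(2) by blast
      moreover have "dist q y < \<eta>" using that k(5) \<rho>1(2) \<rho>'(3) by (auto simp: dist_commute)
      ultimately show False by simp
    qed
    ultimately show ?thesis by auto
  qed
  then have lC: "path_image l \<subseteq> Cm \<union> Cp" using C(4) by blast
  have a0: "0 < a" using k(2) t1 by (auto simp: abs_less_iff)
  define e where "e = min a \<epsilon> / 2"
  have e: "0 < e" "e < a" "e < \<epsilon>" using a0 sec(1) by (auto simp: e_def)
  have "x \<notin> Cp" using C(5)[of x "a - e"] C(6)[of e] C(3) e by auto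
  moreover have "x \<in> path_image l" "w \<in> path_image l" using l by auto
  moreover have "connected (path_image l)" using l(1) by (rule connected_path_image)
  ultimately have "w \<in> Cm"
    using lC connectedD[of "path_image l" Cm Cp] C(1-3) by blast
  then obtain t where t: "b' + \<epsilon>/2 \<le> t" "\<psi> t x \<in> Cm"
    using omega_limit_visits[OF w(1) C(1)] by blast
  have "\<psi> t x \<in> Cp" using C(5)[OF Cpb, of "t - (b' + \<epsilon>/2)"] t(1) by (simp add: flow_add[symmetric])
  with t(2) C(3) show False by blast
qed

text \<open>Limit sets are closed and invariant.\<close>

lemma limit_points_of_limit_points:
  assumes y: "y \<in> omega_limit (\<lambda>t. \<psi> t x)"
    and z: "z \<in> omega_limit (\<lambda>t. \<psi> t y) \<union> alpha_limit (\<lambda>t. \<psi> t y)"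
  shows "z \<in> omega_limit (\<lambda>t. \<psi> t x)"
  unfolding omega_limit_metric_iff
proof (intro allI impI)
  fix T and e :: real assume e: "0 < e"
  have zb: "z \<in> ball z (e/2)" using e by simp
  obtain s where s: "\<psi> s y \<in> ball z (e/2)"
    using z omega_limit_visits[OF _ open_ball zb] alpha_limit_visits[OF _ open_ball zb] by blast
  obtain t where t: "T \<le> t" "\<psi> t x \<in> ball (\<psi> s y) (e/2)"
    using omega_limit_visits[OF omega_limit_invariant[OF y, of s] open_ball, of "\<psi> s y" "e/2" T] e by auto
  have "dist (\<psi> t x) z < e"
    by (rule dist_triangle_half_r[of "\<psi> s y"]) (use s t in \<open>auto simp: dist_commute\<close>)
  with t(1) show "\<exists>t\<ge>T. dist (\<psi> t x) z < e" by blast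
qed

theorem plane_poincare_bendixson:
  obtains
    (periodic) y T h where "0 < T" "\<psi> T y = y" "\<psi> h y \<noteq> y" "omega_limit (\<lambda>t. \<psi> t x) = range (\<lambda>t. \<psi> t y)"
  | (connecting) "\<And>y z h. y \<in> omega_limit (\<lambda>t. \<psi> t x) \<Longrightarrow>
       z \<in> omega_limit (\<lambda>t. \<psi> t y) \<union> alpha_limit (\<lambda>t. \<psi> t y) \<Longrightarrow> \<psi> h z = z"
proof (cases "\<exists>y z h. y \<in> omega_limit (\<lambda>t. \<psi> t x) \<and>
       z \<in> omega_limit (\<lambda>t. \<psi> t y) \<union> alpha_limit (\<lambda>t. \<psi> t y) \<and> \<psi> h z \<noteq> z")
  case False
  then show ?thesis using connecting by blast
next
  case True
  then obtain y z h where yz: "y \<in> omega_limit (\<lambda>t. \<psi> t x)"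
    "z \<in> omega_limit (\<lambda>t. \<psi> t y) \<union> alpha_limit (\<lambda>t. \<psi> t y)" "\<psi> h z \<noteq> z" by blast
  then obtain T where T: "0 < T" "\<psi> T y = y" using recurrence_near_moving_point_periodic by blast
  have "\<exists>h. \<psi> h y \<noteq> y"
  proof (rule ccontr)
    assume "\<nexists>h. \<psi> h y \<noteq> y"
    then have "(\<lambda>t. \<psi> t y) = (\<lambda>t. y)" by auto
    with yz(2) have "z = y" by (auto simp: omega_limit_def alpha_limit_def tendsto_const_iff LIMSEQ_const_iff)
    with \<open>\<nexists>h. \<psi> h y \<noteq> y\<close> yz(3) show False by blast
  qed
  then obtain h' where h': "\<psi> h' y \<noteq> y" by blast
  show ?thesis by (rule periodic[OF T h' periodic_orbit_is_whole_limit_set[OF yz(1) T h']])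
qed

end

section \<open>The measure of noncompactness and convergent subsequences\<close>

lemma kuratowski_mono:
  assumes "A \<subseteq> B"
  shows "kuratowski A \<le> kuratowski B"
  unfolding kuratowski_def by (rule Inf_superset_mono) (use assms in blast)

lemma kuratowski_le_diameter:
  assumes "bounded B"
  shows "kuratowski B \<le> ennreal (diameter B)"
  unfolding kuratowski_def
proof (rule Inf_lower, rule CollectI, rule exI[of _ "diameter B"], intro conjI)
  show "\<exists>F. finite F \<and> B \<subseteq> \<Union>F \<and> (\<forall>S\<in>F. bounded S \<and> diameter S \<le> diameter B)"
    by (rule exI[of _ "{B}"]) (use assms in auto)
qed (simp_all add: assms diameter_ge_0)

lemma kuratowski_less_cover:
  assumes "kuratowski B < ennreal e"
  obtains F where "finite F" "B \<subseteq> \<Union>F" "\<And>S. S \<in> F \<Longrightarrow> bounded S \<and> diameter S < e"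
proof -
  obtain d F where d: "ennreal d < ennreal e" "d \<ge> 0"
    and F: "finite F" "B \<subseteq> \<Union>F" "\<forall>S\<in>F. bounded S \<and> diameter S \<le> d"
    using assms unfolding kuratowski_def Inf_less_iff by auto
  have "d < e" using d by (metis ennreal_less_iff)
  with F that[of F] show ?thesis by fastforce
qed

text \<open>Finite sets do not matter for the measure of noncompactness, so a sequence whose tails become
arbitrarily compact has totally bounded range.\<close>

lemma kuratowski_tails_convergent_subseq:
  fixes a :: "nat \<Rightarrow> 'a::banach"
  assumes "\<forall>e>0. \<exists>N. kuratowski (a ` {N..}) < ennreal e"
  obtains r l where "strict_mono r" "(a \<circ> r) \<longlonglongrightarrow> l"
proof -
  have "\<exists>k. finite k \<and> closure (range a) \<subseteq> (\<Union>x\<in>k. ball x e)" if "0 < e" for e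
  proof -
    obtain N where "kuratowski (a ` {N..}) < ennreal (e/2)" using assms \<open>0 < e\<close> half_gt_zero by blast
    then obtain F where F: "finite F" "a ` {N..} \<subseteq> \<Union>F" "\<And>S. S \<in> F \<Longrightarrow> bounded S \<and> diameter S < e/2"
      using kuratowski_less_cover by blast
    define k where "k = a ` {..<N} \<union> (\<lambda>S. SOME x. x \<in> S) ` F"
    have "finite k" using F(1) by (simp add: k_def)
    have "range a \<subseteq> (\<Union>x\<in>k. cball x (e/2))"
    proof
      fix y assume "y \<in> range a"
      then obtain n where n: "y = a n" by auto
      show "y \<in> (\<Union>x\<in>k. cball x (e/2))"
      proof (cases "n < N")
        case True
        then have "y \<in> k" by (simp add: n k_def)
        with \<open>0 < e\<close> show ?thesis by force
      next
        case False
        then have "y \<in> \<Union>F" using F(2) n by (metis atLeast_iff image_eqI not_less subsetD)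
          then obtain S where S: "S \<in> F" "y \<in> S" by blast
        define x where "x = (SOME x. x \<in> S)"
        have x: "x \<in> S" using S(2) by (auto simp: x_def intro: someI)
        have "dist x y \<le> diameter S" using diameter_bounded_bound[of S x y] F(3)[OF S(1)] x S(2) by auto
        then have "y \<in> cball x (e/2)" using F(3)[OF S(1)] by simp
        moreover have "x \<in> k" using S(1) by (auto simp: k_def x_def)
        ultimately show ?thesis by blast
      qed
    qed
    moreover have "closed (\<Union>x\<in>k. cball x (e/2))" using \<open>finite k\<close> by (intro closed_UN) auto
    ultimately have "closure (range a) \<subseteq> (\<Union>x\<in>k. cball x (e/2))" by (rule closure_minimal)
    also have "\<dots> \<subseteq> (\<Union>x\<in>k. ball x e)" using \<open>0 < e\<close> by (intro UN_mono order_refl) auto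
    finally show ?thesis using \<open>finite k\<close> by blast
  qed
  then have "compact (closure (range a))"
    unfolding compact_eq_totally_bounded by (simp add: complete_eq_closed)
  then have "seq_compact (closure (range a))" by (simp add: compact_eq_seq_compact_metric)
  then obtain l r where "strict_mono r" "(a \<circ> r) \<longlonglongrightarrow> l"
    using seq_compactE[of "closure (range a)" a] closure_subset[of "range a"] by (metis rangeI subsetD)
  then show ?thesis using that by blast
qed

section \<open>Semiflows with a squeezed quadratic form\<close>

definition trajectory_from :: "(real \<Rightarrow> 'e \<Rightarrow> 'e) \<Rightarrow> real \<Rightarrow> (real \<Rightarrow> 'e) \<Rightarrow> bool" where
  "trajectory_from \<phi> a u \<longleftrightarrow> (\<forall>s\<ge>a. \<forall>t\<ge>0. u (t + s) = \<phi> t (u s))"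

lemma complete_trajectory_from: "complete_trajectory \<phi> u \<Longrightarrow> trajectory_from \<phi> a u"
  by (auto simp: complete_trajectory_def trajectory_from_def)

lemma trajectory_fromD: "trajectory_from \<phi> a u \<Longrightarrow> a \<le> s \<Longrightarrow> s \<le> t \<Longrightarrow> u t = \<phi> (t - s) (u s)"
  unfolding trajectory_from_def by (metis diff_add_cancel diff_ge_0_iff_ge)

lemma complete_trajectoryD: "complete_trajectory \<phi> u \<Longrightarrow> s \<le> t \<Longrightarrow> u t = \<phi> (t - s) (u s)"
  using trajectory_fromD[OF complete_trajectory_from order_refl] .

lemma quad_form_tendsto [tendsto_intros]:
  "(f \<longlongrightarrow> x) F \<Longrightarrow> ((\<lambda>a. quad_form P (f a)) \<longlongrightarrow> quad_form P x) F"
  unfolding quad_form_def by (intro tendsto_intros)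

lemma quad_form_abs_le: "\<bar>quad_form P v\<bar> \<le> norm P * (norm v)\<^sup>2"
proof -
  have "norm (blinfun_apply (blinfun_apply P v) v) \<le> norm (blinfun_apply P v) * norm v" by (rule norm_blinfun)
  also have "\<dots> \<le> (norm P * norm v) * norm v" by (intro mult_right_mono norm_blinfun norm_ge_zero)
  finally show ?thesis by (simp add: quad_form_def power2_eq_square mult.assoc)
qed

lemma quad_form_diff:
  assumes "symmetric_op P"
  shows "quad_form P (a - b) = quad_form P a - 2 * blinfun_apply (blinfun_apply P a) b + quad_form P b"
  using assms by (simp add: quad_form_def blinfun.diff_left blinfun.diff_right symmetric_op_def)

text \<open>What the geometry of the problem amounts to: \<open>Q\<close> are two coordinates such that \<open>V v < 0\<close> forces
\<open>Q v \<noteq> 0\<close>, \<open>j\<close> spans a plane on which \<open>V\<close> is negative definite, and the weighted form of the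
difference of two solutions decreases by an amount that controls their distance in \<open>'e\<close>.\<close>

locale cone_semiflow =
  fixes \<phi> :: "real \<Rightarrow> 'e \<Rightarrow> 'e::banach"
    and P :: "'e \<Rightarrow>\<^sub>L ('e \<Rightarrow>\<^sub>L real)"
    and Q :: "'e \<Rightarrow> complex" and j :: "complex \<Rightarrow> 'e"
    and lam kap C :: real
  assumes sf: "semiflow \<phi>" and sym: "symmetric_op P"
    and Q: "bounded_linear Q" and j: "bounded_linear j"
    and form_ge: "- (norm (Q v))\<^sup>2 \<le> quad_form P v"
    and form_j: "quad_form P (j z) = - (norm z)\<^sup>2"
    and lam: "0 \<le> lam" and kap: "0 < kap" and C: "0 < C"
    and squeeze: "\<lbrakk>0 \<le> l; l + kap \<le> t; t \<le> r\<rbrakk> \<Longrightarrow>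
      exp (2 * lam * t) * (norm (\<phi> t v1 - \<phi> t v2))\<^sup>2
        \<le> C * (exp (2 * lam * l) * quad_form P (\<phi> l v1 - \<phi> l v2)
               - exp (2 * lam * r) * quad_form P (\<phi> r v1 - \<phi> r v2))"
    and ac: "asymptotically_compact \<phi> lam"
begin

abbreviation V :: "'e \<Rightarrow> real" where "V \<equiv> quad_form P"

lemma semiflow_zero [simp]: "\<phi> 0 v = v"
  using sf by (simp add: semiflow_def)

lemma semiflow_add: "0 \<le> t \<Longrightarrow> 0 \<le> s \<Longrightarrow> \<phi> (t + s) v = \<phi> t (\<phi> s v)"
  using sf by (simp add: semiflow_def)

lemma semiflow_continuous_on:
  assumes "continuous_on A f" "continuous_on A g" "\<And>a. a \<in> A \<Longrightarrow> 0 \<le> f a"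
  shows "continuous_on A (\<lambda>a. \<phi> (f a) (g a))"
proof -
  have "continuous_on ({0..} \<times> UNIV) (\<lambda>(t, v). \<phi> t v)" using sf by (simp add: semiflow_def)
  from continuous_on_compose2[OF this continuous_on_Pair[OF assms(1,2)]] assms(3)
  show ?thesis by (auto simp: image_subset_iff)
qed

lemma semiflow_tendsto:
  assumes "0 \<le> t" "(f \<longlongrightarrow> v) F"
  shows "((\<lambda>a. \<phi> t (f a)) \<longlongrightarrow> \<phi> t v) F"
proof -
  have "continuous_on UNIV (\<phi> t)"
    using semiflow_continuous_on[of UNIV "\<lambda>_. t" "\<lambda>v. v"] assms(1) by (simp add: continuous_on_id)
  then have "isCont (\<phi> t) v" by (simp add: continuous_on_eq_continuous_at)
  from isCont_tendsto_compose[OF this assms(2)] show ?thesis .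
qed

lemma forward_trajectory: "trajectory_from \<phi> 0 (\<lambda>t. \<phi> t v)"
  by (auto simp: trajectory_from_def semiflow_add)

lemma Q_tendsto: "(f \<longlongrightarrow> v) F \<Longrightarrow> ((\<lambda>a. Q (f a)) \<longlongrightarrow> Q v) F"
  by (rule bounded_linear.tendsto[OF Q])

lemma Q_diff: "Q (a - b) = Q a - Q b"
  using Q by (simp add: bounded_linear.linear linear_diff)

text \<open>The squeezing inequality is invariant under time shifts, as both sides scale by the same
exponential. So it also holds at negative times, where the limit to \<open>- \<infinity>\<close> can be taken.\<close>

lemma squeeze_trajectories:
  assumes u: "trajectory_from \<phi> a u1" "trajectory_from \<phi> a u2"
    and t: "a \<le> l" "l + kap \<le> t" "t \<le> r"
  shows "exp (2 * lam * t) * (norm (u1 t - u2 t))\<^sup>2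
        \<le> C * (exp (2 * lam * l) * V (u1 l - u2 l) - exp (2 * lam * r) * V (u1 r - u2 r))"
proof -
  have e: "exp (2 * lam * s) = exp (2 * lam * a) * exp (2 * lam * (s - a))" for s
    by (simp add: exp_add[symmetric] algebra_simps)
  have at: "u1 s = \<phi> (s - a) (u1 a)" "u2 s = \<phi> (s - a) (u2 a)" if "a \<le> s" for s
    using trajectory_fromD[OF u(1) order_refl that] trajectory_fromD[OF u(2) order_refl that] by simp_all
  have "exp (2 * lam * (t - a)) * (norm (\<phi> (t - a) (u1 a) - \<phi> (t - a) (u2 a)))\<^sup>2
        \<le> C * (exp (2 * lam * (l - a)) * V (\<phi> (l - a) (u1 a) - \<phi> (l - a) (u2 a))
               - exp (2 * lam * (r - a)) * V (\<phi> (r - a) (u1 a) - \<phi> (r - a) (u2 a)))"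
    by (rule squeeze) (use t in auto)
  then have "exp (2 * lam * (t - a)) * (norm (u1 t - u2 t))\<^sup>2
        \<le> C * (exp (2 * lam * (l - a)) * V (u1 l - u2 l) - exp (2 * lam * (r - a)) * V (u1 r - u2 r))"
    using at[of t] at[of l] at[of r] t kap by simp
  then have "exp (2 * lam * a) * (exp (2 * lam * (t - a)) * (norm (u1 t - u2 t))\<^sup>2)
        \<le> exp (2 * lam * a) * (C * (exp (2 * lam * (l - a)) * V (u1 l - u2 l) - exp (2 * lam * (r - a)) * V (u1 r - u2 r)))"
    by (intro mult_left_mono) auto
  then show ?thesis unfolding e[of t] e[of l] e[of r] by (simp add: algebra_simps)
qed

lemma form_decreasing:
  assumes "trajectory_from \<phi> a u1" "trajectory_from \<phi> a u2" "a \<le> l" "l + kap \<le> r"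
  shows "exp (2 * lam * r) * V (u1 r - u2 r) \<le> exp (2 * lam * l) * V (u1 l - u2 l)"
proof -
  have "0 \<le> exp (2 * lam * r) * (norm (u1 r - u2 r))\<^sup>2" by simp
  also have "\<dots> \<le> C * (exp (2 * lam * l) * V (u1 l - u2 l) - exp (2 * lam * r) * V (u1 r - u2 r))"
    by (rule squeeze_trajectories[OF assms order_refl])
  finally show ?thesis using C by (simp add: zero_le_mult_iff)
qed

text \<open>These are the trajectories on the inertial manifold: the growth backward in time is that of
\<open>exp (- lam * t)\<close>, at which the weighted form stays bounded.\<close>

definition amenable :: "(real \<Rightarrow> 'e) \<Rightarrow> bool" where
  "amenable u \<longleftrightarrow> complete_trajectory \<phi> u \<and> (\<exists>M. \<forall>t\<le>0. exp (lam * t) * norm (u t) \<le> M)"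

lemma amenable_complete: "amenable u \<Longrightarrow> complete_trajectory \<phi> u"
  by (simp add: amenable_def)

text \<open>Along a pair of amenable trajectories the weighted form \<open>F\<close> is bounded and decreasing, so it hardly
changes over a fixed time span in the far past. By the squeezing inequality the weighted distance
then tends to 0, and so does \<open>F\<close>. Now let \<open>l\<close> tend to \<open>- \<infinity>\<close> in the squeezing inequality.\<close>

lemma amenable_pair_form:
  assumes u: "amenable u1" "amenable u2" and tr: "t \<le> r"
  shows "exp (2 * lam * t) * (norm (u1 t - u2 t))\<^sup>2 \<le> - C * (exp (2 * lam * r) * V (u1 r - u2 r))"
proof -
  define D where "D t = u1 t - u2 t" for t
  define F where "F t = exp (2 * lam * t) * V (D t)" for t
  note traj = complete_trajectory_from[OF amenable_complete[OF u(1)]] complete_trajectory_from[OF amenable_complete[OF u(2)]]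
  have sq: "exp (2 * lam * t) * (norm (D t))\<^sup>2 \<le> C * (F l - F r)" if "l + kap \<le> t" "t \<le> r" for l t r
    unfolding F_def D_def by (rule squeeze_trajectories[OF traj[of l] order_refl that])
  obtain M1 M2 where "\<forall>t\<le>0. exp (lam * t) * norm (u1 t) \<le> M1" "\<forall>t\<le>0. exp (lam * t) * norm (u2 t) \<le> M2"
    using u by (auto simp: amenable_def)
  then have M: "exp (lam * t) * norm (D t) \<le> M1 + M2" if "t \<le> 0" for t
  proof -
    have "exp (lam * t) * norm (D t) \<le> exp (lam * t) * (norm (u1 t) + norm (u2 t))"
      unfolding D_def by (intro mult_left_mono norm_triangle_ineq4) auto
    with \<open>\<forall>t\<le>0. exp (lam * t) * norm (u1 t) \<le> M1\<close> \<open>\<forall>t\<le>0. exp (lam * t) * norm (u2 t) \<le> M2\<close> that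
    show ?thesis by (fastforce simp: distrib_left)
  qed
  have sqr: "exp (2 * lam * t) * (norm v)\<^sup>2 = (exp (lam * t) * norm v)\<^sup>2" for t and v :: 'e
    by (simp add: power_mult_distrib exp_double[symmetric] algebra_simps)
  have FD: "\<bar>F t\<bar> \<le> norm P * (exp (2 * lam * t) * (norm (D t))\<^sup>2)" for t
  proof -
    have "\<bar>F t\<bar> = exp (2 * lam * t) * \<bar>V (D t)\<bar>" by (simp add: F_def abs_mult)
    also have "\<dots> \<le> exp (2 * lam * t) * (norm P * (norm (D t))\<^sup>2)"
      by (intro mult_left_mono quad_form_abs_le) auto
    finally show ?thesis by (simp add: algebra_simps)
  qed
  have Fb: "F t \<le> norm P * (M1 + M2)\<^sup>2" if "t \<le> 0" for t
  proof -
    have "(exp (lam * t) * norm (D t))\<^sup>2 \<le> (M1 + M2)\<^sup>2" using M[OF that] by (intro power_mono) auto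
    then have "norm P * (exp (2 * lam * t) * (norm (D t))\<^sup>2) \<le> norm P * (M1 + M2)\<^sup>2"
      unfolding sqr by (intro mult_left_mono) auto
    with FD[of t] show ?thesis by linarith
  qed
  have small: "\<exists>l0. \<forall>t\<le>l0. exp (2 * lam * t) * (norm (D t))\<^sup>2 \<le> e" if "0 < e" for e
  proof -
    define m where "m = (SUP t\<in>{..0}. F t)"
    have bdd: "bdd_above (F ` {..0})" using Fb by (intro bdd_aboveI2[of _ _ "norm P * (M1 + M2)\<^sup>2"]) auto
    have "m - e / C < (SUP t\<in>{..0}. F t)" using \<open>0 < e\<close> C by (simp add: m_def)
    then obtain l0 where l0: "l0 \<le> 0" "m - e / C < F l0"
      using less_cSUP_iff[OF _ bdd] by auto
    have "exp (2 * lam * t) * (norm (D t))\<^sup>2 \<le> e" if "t \<le> l0 - kap" for t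
    proof -
      have "exp (2 * lam * t) * (norm (D t))\<^sup>2 \<le> C * (F (t - kap) - F l0)"
        by (rule sq) (use that kap in auto)
      also have "F (t - kap) \<le> m" unfolding m_def by (rule cSUP_upper[OF _ bdd]) (use that l0 kap in auto)
      then have "C * (F (t - kap) - F l0) \<le> C * (e / C)" using l0 C by (intro mult_left_mono) auto
      finally show ?thesis using C by simp
    qed
    then show ?thesis by blast
  qed
  have "exp (2 * lam * t) * (norm (D t))\<^sup>2 \<le> - C * F r + e" if "0 < e" for e
  proof -
    define e' where "e' = e / (C * (norm P + 1))"
    have nP: "0 < norm P + 1" by (simp add: add_nonneg_pos)
    have "0 < e'" unfolding e'_def using \<open>0 < e\<close> C nP by simp
    from small[OF this] obtain l0 where l0: "\<And>t. t \<le> l0 \<Longrightarrow> exp (2 * lam * t) * (norm (D t))\<^sup>2 \<le> e'" by blast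
    define l where "l = min l0 (t - kap)"
    have "F l \<le> norm P * (exp (2 * lam * l) * (norm (D l))\<^sup>2)" using FD[of l] by linarith
    also have "\<dots> \<le> norm P * e'" using l0[of l] by (intro mult_left_mono) (auto simp: l_def)
    also have "\<dots> \<le> (norm P + 1) * e'" using \<open>0 < e'\<close> by (simp add: algebra_simps)
    finally have "C * F l \<le> C * ((norm P + 1) * e')" using C by (simp add: mult_left_mono)
    also have "\<dots> = e" using C nP by (simp add: e'_def)
    finally have "C * F l \<le> e" .
    moreover have "exp (2 * lam * t) * (norm (D t))\<^sup>2 \<le> C * (F l - F r)"
      by (rule sq) (use tr in \<open>auto simp: l_def\<close>)
    ultimately show ?thesis by (simp add: algebra_simps)
  qed
  then have "exp (2 * lam * t) * (norm (D t))\<^sup>2 \<le> - C * F r" by (rule field_le_epsilon)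
  then show ?thesis by (simp add: F_def D_def)
qed

lemma amenable_pair_Q:
  assumes "amenable u1" "amenable u2" "t \<le> r"
  shows "exp (2 * lam * t) * (norm (u1 t - u2 t))\<^sup>2 \<le> C * exp (2 * lam * r) * (norm (Q (u1 r) - Q (u2 r)))\<^sup>2"
proof -
  have "exp (2 * lam * t) * (norm (u1 t - u2 t))\<^sup>2 \<le> C * exp (2 * lam * r) * (- V (u1 r - u2 r))"
    using amenable_pair_form[OF assms] by simp
  also have "\<dots> \<le> C * exp (2 * lam * r) * (norm (Q (u1 r - u2 r)))\<^sup>2"
    using form_ge[of "u1 r - u2 r"] C by (intro mult_left_mono) auto
  finally show ?thesis by (simp add: Q_diff)
qed

lemma amenable_unique:
  assumes "amenable u1" "amenable u2" "Q (u1 0) = Q (u2 0)"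
  shows "u1 = u2"
proof
  fix t
  have neg: "u1 s = u2 s" if "s \<le> 0" for s
    using amenable_pair_Q[OF assms(1,2) that] assms(3) by (simp add: mult_le_0_iff)
  show "u1 t = u2 t"
    using neg[of t] neg[of 0] complete_trajectoryD[OF amenable_complete[OF assms(1)], of 0 t]
      complete_trajectoryD[OF amenable_complete[OF assms(2)], of 0 t] by (cases "t \<le> 0") auto
qed

lemma amenable_shift:
  assumes "amenable u"
  shows "amenable (\<lambda>t. u (t + s))"
proof -
  obtain M where M: "\<And>t. t \<le> 0 \<Longrightarrow> exp (lam * t) * norm (u t) \<le> M"
    using assms by (auto simp: amenable_def)
  have "compact ((\<lambda>t. \<phi> t (u 0)) ` {0..\<bar>s\<bar>})"
    by (intro compact_continuous_image semiflow_continuous_on continuous_intros) auto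
  then obtain K where "\<forall>p\<in>(\<lambda>t. \<phi> t (u 0)) ` {0..\<bar>s\<bar>}. norm p \<le> K"
    using compact_imp_bounded bounded_iff by blast
  then have K: "\<And>t. 0 \<le> t \<Longrightarrow> t \<le> \<bar>s\<bar> \<Longrightarrow> norm (\<phi> t (u 0)) \<le> K" by auto
  have "exp (lam * t) * norm (u (t + s)) \<le> max (exp (- lam * s) * M) K" if "t \<le> 0" for t
  proof (cases "t + s \<le> 0")
    case True
    have "exp (lam * t) * norm (u (t + s)) = exp (- lam * s) * (exp (lam * (t + s)) * norm (u (t + s)))"
      by (simp add: exp_add[symmetric] algebra_simps flip: mult.assoc)
    also have "\<dots> \<le> exp (- lam * s) * M" by (intro mult_left_mono M True) auto
    finally show ?thesis by simp
  next
    case False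
    have "exp (lam * t) \<le> 1" using that lam by (simp add: mult_nonneg_nonpos)
    moreover have "norm (u (t + s)) \<le> K"
      using complete_trajectoryD[OF amenable_complete[OF assms], of 0 "t + s"] K[of "t + s"] False that by simp
    ultimately have "exp (lam * t) * norm (u (t + s)) \<le> 1 * K" by (intro mult_mono) auto
    then show ?thesis by simp
  qed
  moreover have "complete_trajectory \<phi> (\<lambda>t. u (t + s))"
    using amenable_complete[OF assms] by (simp add: complete_trajectory_def add.assoc)
  ultimately show ?thesis unfolding amenable_def by blast
qed

text \<open>The decay of the measure of noncompactness beats the growth \<open>exp (lam * S)\<close> of the sets from which
amenable trajectories come at time \<open>- S\<close>.\<close>

lemma compactness_gain:
  assumes "0 < e" "0 \<le> M"
  obtains S where "0 \<le> S"
    "\<And>B. bounded B \<Longrightarrow> kuratowski B \<le> ennreal (M * exp (lam * S)) \<Longrightarrow> kuratowski (\<phi> S ` B) < ennreal e"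
proof -
  obtain \<gamma>0 where \<gamma>: "\<And>t. 0 \<le> t \<Longrightarrow> \<gamma>0 t \<ge> 0" "(\<gamma>0 \<longlongrightarrow> 0) at_top"
    "\<And>t B. 0 \<le> t \<Longrightarrow> bounded B \<Longrightarrow>
       kuratowski (\<phi> t ` B) \<le> ennreal (\<gamma>0 t * exp (- lam * t)) * kuratowski B"
    using ac unfolding asymptotically_compact_def by blast
  have "0 < e / (M + 1)" using assms by simp
  then have "\<forall>\<^sub>F t in at_top. \<gamma>0 t < e / (M + 1) \<and> 0 \<le> t"
    using order_tendstoD(2)[OF \<gamma>(2)] eventually_ge_at_top by (intro eventually_conj) auto
  then obtain S where S: "\<gamma>0 S < e / (M + 1)" "0 \<le> S"
    using eventually_happens'[OF trivial_limit_at_top_linorder] by blast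
  have "kuratowski (\<phi> S ` B) < ennreal e"
    if "bounded B" "kuratowski B \<le> ennreal (M * exp (lam * S))" for B
  proof -
    have "kuratowski (\<phi> S ` B) \<le> ennreal (\<gamma>0 S * exp (- lam * S)) * ennreal (M * exp (lam * S))"
      using \<gamma>(3)[OF S(2) that(1)] that(2) by (meson mult_left_mono order_trans zero_le)
    also have "\<dots> = ennreal (\<gamma>0 S * M)"
      using \<gamma>(1)[OF S(2)] assms(2) by (simp add: ennreal_mult[symmetric] exp_minus)
    also have "\<dots> < ennreal e"
    proof (rule ennreal_lessI[OF assms(1)])
      have "\<gamma>0 S * M \<le> \<gamma>0 S * (M + 1)" using \<gamma>(1)[OF S(2)] by (intro mult_left_mono) auto
      also have "\<dots> < e" using S(1) assms(2) by (simp add: field_simps)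
      finally show "\<gamma>0 S * M < e" .
    qed
    finally show ?thesis .
  qed
  with S(2) that show ?thesis by blast
qed

text \<open>The states at time \<open>- k\<close> are images of states from \<open>S\<close> time units earlier, so their tails are
arbitrarily compact. A diagonal sequence converges at all times \<open>- k\<close>, hence at all times by
continuity of the semiflow.\<close>

lemma limit_trajectory:
  fixes u :: "nat \<Rightarrow> real \<Rightarrow> 'e"
  assumes traj: "\<And>n. trajectory_from \<phi> (- real n) (u n)"
    and cpt: "\<And>k::nat. \<exists>M\<ge>0. \<forall>S\<ge>0. \<exists>N B. bounded B \<and> kuratowski B \<le> ennreal (M * exp (lam * S)) \<and>
               (\<forall>n\<ge>N. u n (- real k) \<in> \<phi> S ` B)"
  obtains r w where "strict_mono r" "complete_trajectory \<phi> w" "\<And>t. (\<lambda>n. u (r n) t) \<longlonglongrightarrow> w t"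
proof -
  have tails: "\<exists>N. kuratowski ((\<lambda>n. u n (- real k)) ` {N..}) < ennreal e" if e: "0 < e" for k e
  proof -
    obtain M where M: "M \<ge> 0" "\<And>S. 0 \<le> S \<Longrightarrow> \<exists>N B. bounded B \<and> kuratowski B \<le> ennreal (M * exp (lam * S)) \<and>
               (\<forall>n\<ge>N. u n (- real k) \<in> \<phi> S ` B)" using cpt[of k] by blast
    obtain S where S: "0 \<le> S"
      "\<And>B. bounded B \<Longrightarrow> kuratowski B \<le> ennreal (M * exp (lam * S)) \<Longrightarrow> kuratowski (\<phi> S ` B) < ennreal e"
      by (rule compactness_gain[OF e M(1)]) (rule that; assumption)
    obtain N B where B: "bounded B" "kuratowski B \<le> ennreal (M * exp (lam * S))"
      "\<And>n. n \<ge> N \<Longrightarrow> u n (- real k) \<in> \<phi> S ` B" using M(2)[OF S(1)] by blast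
    have "kuratowski ((\<lambda>n. u n (- real k)) ` {N..}) \<le> kuratowski (\<phi> S ` B)"
      by (rule kuratowski_mono) (use B(3) in blast)
    with S(2)[OF B(1,2)] show ?thesis by (meson le_less_trans)
  qed
  interpret subseqs "\<lambda>k s. \<exists>l. (\<lambda>n. u (s n) (- real k)) \<longlonglongrightarrow> l"
  proof
    fix k :: nat and s :: "nat \<Rightarrow> nat" assume s: "strict_mono s"
    have "\<forall>e>0. \<exists>N. kuratowski ((\<lambda>n. u (s n) (- real k)) ` {N..}) < ennreal e"
    proof (intro allI impI)
      fix e :: real assume "0 < e"
      then obtain N where N: "kuratowski ((\<lambda>n. u n (- real k)) ` {N..}) < ennreal e" using tails by blast
      have "s n \<in> {N..}" if "n \<in> {N..}" for n using seq_suble[OF s, of n] that by simp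
      then have "kuratowski ((\<lambda>n. u (s n) (- real k)) ` {N..}) \<le> kuratowski ((\<lambda>n. u n (- real k)) ` {N..})"
        by (intro kuratowski_mono) blast
      with N show "\<exists>N. kuratowski ((\<lambda>n. u (s n) (- real k)) ` {N..}) < ennreal e" by (meson le_less_trans)
    qed
    then obtain r' l where "strict_mono r'" "((\<lambda>n. u (s n) (- real k)) \<circ> r') \<longlonglongrightarrow> l"
      by (rule kuratowski_tails_convergent_subseq)
    then show "\<exists>r'. strict_mono r' \<and> (\<exists>l. (\<lambda>n. u ((s \<circ> r') n) (- real k)) \<longlonglongrightarrow> l)"
      by (auto simp: o_def)
  qed
  define r where "r = diagseq"
  have r: "strict_mono r" unfolding r_def by (rule subseq_diagseq)
  have "\<exists>l. (\<lambda>n. u (r n) (- real k)) \<longlonglongrightarrow> l" for k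
  proof -
    have "\<exists>l. (\<lambda>n. u ((diagseq \<circ> (+) (Suc k)) n) (- real k)) \<longlonglongrightarrow> l"
    proof (rule diagseq_holds)
      fix r s :: "nat \<Rightarrow> nat" and n assume "strict_mono r" "\<exists>l. (\<lambda>m. u (s m) (- real n)) \<longlonglongrightarrow> l"
      then show "\<exists>l. (\<lambda>m. u ((s \<circ> r) m) (- real n)) \<longlonglongrightarrow> l"
        using LIMSEQ_subseq_LIMSEQ by (fastforce simp: o_def)
    qed
    then obtain l where "(\<lambda>n. u (r (n + Suc k)) (- real k)) \<longlonglongrightarrow> l" by (auto simp: r_def add.commute)
    then have "(\<lambda>n. u (r n) (- real k)) \<longlonglongrightarrow> l" by (rule LIMSEQ_offset)
    then show ?thesis ..
  qed
  then obtain p where p: "\<And>k. (\<lambda>n. u (r n) (- real k)) \<longlonglongrightarrow> p k" by metis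
  have late: "\<forall>\<^sub>F n in sequentially. - real (r n) \<le> s" for s
  proof -
    obtain N :: nat where "- s \<le> real N" using real_arch_simple by blast
    moreover have "n \<le> r n" for n by (rule seq_suble[OF r])
    ultimately have "- real (r n) \<le> s" if "N \<le> n" for n
      using that by (smt (verit, best) of_nat_le_iff)
    then show ?thesis unfolding eventually_sequentially by blast
  qed
  have conv: "\<exists>l. (\<lambda>n. u (r n) t) \<longlonglongrightarrow> l" for t
  proof -
    obtain k :: nat where k: "- t \<le> real k" using real_arch_simple by blast
    have "(\<lambda>n. \<phi> (t + real k) (u (r n) (- real k))) \<longlonglongrightarrow> \<phi> (t + real k) (p k)"
      by (rule semiflow_tendsto) (use k p in auto)
    moreover have "\<forall>\<^sub>F n in sequentially. \<phi> (t + real k) (u (r n) (- real k)) = u (r n) t"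
      using late[of "- real k"]
    proof eventually_elim
      case (elim n)
      then show ?case using trajectory_fromD[OF traj[of "r n"], of "- real k" t] k by simp
    qed
    ultimately have "(\<lambda>n. u (r n) t) \<longlonglongrightarrow> \<phi> (t + real k) (p k)" by (rule Lim_transform_eventually)
    then show ?thesis ..
  qed
  then obtain w where w: "\<And>t. (\<lambda>n. u (r n) t) \<longlonglongrightarrow> w t" by metis
  have "w (t + s) = \<phi> t (w s)" if "0 \<le> t" for s t
  proof -
    have "(\<lambda>n. \<phi> t (u (r n) s)) \<longlonglongrightarrow> \<phi> t (w s)" by (rule semiflow_tendsto[OF that w])
    moreover have "\<forall>\<^sub>F n in sequentially. \<phi> t (u (r n) s) = u (r n) (t + s)"
      using late[of s]
    proof eventually_elim
      case (elim n)
      then show ?case using traj[of "r n"] that by (simp add: trajectory_from_def)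
    qed
    ultimately have "(\<lambda>n. u (r n) (t + s)) \<longlonglongrightarrow> \<phi> t (w s)" by (rule Lim_transform_eventually)
    with w[of "t + s"] show ?thesis by (rule LIMSEQ_unique)
  qed
  then have "complete_trajectory \<phi> w" by (simp add: complete_trajectory_def)
  with r w that show ?thesis by blast
qed

text \<open>A limit of time shifts of the bounded solution.\<close>

lemma bounded_semiorbit_amenable:
  assumes "bounded (semiorbit \<phi> v)"
  shows "\<exists>w. amenable w"
proof -
  define u where "u n t = \<phi> (t + real n) v" for n t
  have traj: "trajectory_from \<phi> (- real n) (u n)" for n
    by (auto simp: trajectory_from_def u_def semiflow_add[symmetric] add.assoc)
  have cpt: "\<exists>M\<ge>0. \<forall>S\<ge>0. \<exists>N B. bounded B \<and> kuratowski B \<le> ennreal (M * exp (lam * S)) \<and>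
               (\<forall>n\<ge>N. u n (- real k) \<in> \<phi> S ` B)" for k
  proof (intro exI[of _ "diameter (semiorbit \<phi> v)"] conjI allI impI)
    show d: "0 \<le> diameter (semiorbit \<phi> v)" by (rule diameter_ge_0[OF assms])
    fix S :: real assume S: "0 \<le> S"
    obtain N :: nat where N: "real k + S \<le> real N" using real_arch_simple by blast
    have "u n (- real k) \<in> \<phi> S ` semiorbit \<phi> v" if "N \<le> n" for n
    proof -
      have n: "0 \<le> real n - real k - S" using N that by (smt (verit) of_nat_le_iff)
      have "u n (- real k) = \<phi> (S + (real n - real k - S)) v" by (simp add: u_def)
      also have "\<dots> = \<phi> S (\<phi> (real n - real k - S) v)" by (rule semiflow_add[OF S n])
      finally show ?thesis using n by (auto simp: semiorbit_def)
    qed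
    moreover have "kuratowski (semiorbit \<phi> v) \<le> ennreal (diameter (semiorbit \<phi> v) * exp (lam * S))"
    proof (rule order_trans[OF kuratowski_le_diameter[OF assms]], rule ennreal_leI)
      have "1 \<le> exp (lam * S)" using lam S by simp
      then show "diameter (semiorbit \<phi> v) \<le> diameter (semiorbit \<phi> v) * exp (lam * S)"
        using d by (simp add: mult_le_cancel_left1)
    qed
    ultimately show "\<exists>N B. bounded B \<and> kuratowski B \<le> ennreal (diameter (semiorbit \<phi> v) * exp (lam * S)) \<and>
               (\<forall>n\<ge>N. u n (- real k) \<in> \<phi> S ` B)" using assms by blast
  qed
  obtain r w where r: "strict_mono r" and w: "complete_trajectory \<phi> w" "\<And>t. (\<lambda>n. u (r n) t) \<longlonglongrightarrow> w t"
    by (rule limit_trajectory[OF traj cpt]) (rule that; assumption)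
  obtain M where M: "\<And>p. p \<in> semiorbit \<phi> v \<Longrightarrow> norm p \<le> M" using assms by (auto simp: bounded_iff)
  have "exp (lam * t) * norm (w t) \<le> M" if "t \<le> 0" for t
  proof -
    obtain N :: nat where N: "- t \<le> real N" using real_arch_simple by blast
    have "norm (u (r n) t) \<le> M" if "N \<le> n" for n
    proof (rule M)
      have "real N \<le> real (r n)" using seq_suble[OF r, of n] that by simp
      then show "u (r n) t \<in> semiorbit \<phi> v" using N by (auto simp: u_def semiorbit_def)
    qed
    then have "norm (w t) \<le> M"
      using Lim_bounded[OF tendsto_norm[OF w(2)[of t]], of N M] by blast
    moreover have "exp (lam * t) \<le> 1" using that lam by (simp add: mult_nonneg_nonpos)
    ultimately have "exp (lam * t) * norm (w t) \<le> 1 * M" by (intro mult_mono) auto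
    then show ?thesis by simp
  qed
  with w(1) show ?thesis unfolding amenable_def by blast
qed

text \<open>By the squeezing inequality the map from a translate of the negative plane to the coordinates at
time \<open>T\<close> is expanding up to a constant factor. So it is injective with closed range, and the range
is open by invariance of domain.\<close>

lemma negative_plane_onto:
  assumes T: "kap \<le> T"
  shows "\<exists>z. Q (\<phi> T (p + j z)) = c"
proof -
  define h where "h z = Q (\<phi> T (p + j z))" for z
  define K where "K = exp (lam * T)"
  have T0: "0 \<le> T" using T kap by simp
  have K: "0 < K" by (simp add: K_def)
  have cont: "continuous_on UNIV h"
    unfolding h_def
    by (intro bounded_linear.continuous_on[OF Q] semiflow_continuous_on continuous_intros
        bounded_linear.continuous_on[OF j] T0)
  have expand: "dist z1 z2 \<le> K * dist (h z1) (h z2)" for z1 z2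
  proof -
    have "exp (2 * lam * T) * V (\<phi> T (p + j z1) - \<phi> T (p + j z2)) \<le> exp (2 * lam * 0) * V (\<phi> 0 (p + j z1) - \<phi> 0 (p + j z2))"
      by (rule form_decreasing[OF forward_trajectory forward_trajectory order_refl]) (use T in simp)
    moreover have "p + j z1 - (p + j z2) = j (z1 - z2)"
      using j by (simp add: bounded_linear.linear linear_diff)
    ultimately have "exp (2 * lam * T) * V (\<phi> T (p + j z1) - \<phi> T (p + j z2)) \<le> - (norm (z1 - z2))\<^sup>2"
      by (simp add: form_j)
    moreover have "exp (2 * lam * T) * - (norm (h z1 - h z2))\<^sup>2 \<le> exp (2 * lam * T) * V (\<phi> T (p + j z1) - \<phi> T (p + j z2))"
      using form_ge[of "\<phi> T (p + j z1) - \<phi> T (p + j z2)"] by (intro mult_left_mono) (auto simp: Q_diff h_def)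
    ultimately have "(norm (z1 - z2))\<^sup>2 \<le> exp (2 * lam * T) * (norm (h z1 - h z2))\<^sup>2" by linarith
    also have "\<dots> = (K * norm (h z1 - h z2))\<^sup>2"
      by (simp add: K_def power_mult_distrib exp_double[symmetric] algebra_simps)
    finally have "norm (z1 - z2) \<le> K * norm (h z1 - h z2)" by (rule power2_le_imp_le) (use K in simp)
    then show ?thesis by (simp add: dist_norm)
  qed
  have "inj h" using expand by (metis injI dist_eq_0_iff dist_self mult_zero_right dist_le_zero_iff)
  then have "open (range h)" by (rule invariance_of_domain[OF cont open_UNIV])
  moreover have "closed (range h)"
    unfolding closed_sequential_limits
  proof (intro allI impI, elim conjE)
    fix f l assume f: "\<forall>n. f n \<in> range h" "f \<longlonglongrightarrow> l"
    then have "\<forall>n. \<exists>z. f n = h z" by auto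
    then obtain z where z: "\<And>n. f n = h (z n)" by metis
    have "Cauchy z"
    proof (rule metric_CauchyI)
      fix e :: real assume "0 < e"
      then obtain N where N: "\<And>m n. N \<le> m \<Longrightarrow> N \<le> n \<Longrightarrow> dist (f m) (f n) < e / K"
        using metric_CauchyD[OF LIMSEQ_imp_Cauchy[OF f(2)], of "e / K"] K by auto
      have "dist (z m) (z n) < e" if "N \<le> m" "N \<le> n" for m n
        using expand[of "z m" "z n"] N[OF that] K by (simp add: z field_simps)
      then show "\<exists>M. \<forall>m\<ge>M. \<forall>n\<ge>M. dist (z m) (z n) < e" by blast
    qed
    then obtain z0 where z0: "z \<longlonglongrightarrow> z0" using Cauchy_convergent convergent_def by blast
    have "(\<lambda>n. h (z n)) \<longlonglongrightarrow> h z0"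
      using cont by (intro isCont_tendsto_compose[OF _ z0]) (simp add: continuous_on_eq_continuous_at)
    moreover have "(\<lambda>n. h (z n)) \<longlonglongrightarrow> l" using f(2) by (simp add: z[symmetric])
    ultimately have "l = h z0" using LIMSEQ_unique by blast
    then show "l \<in> range h" by simp
  qed
  ultimately have "range h = UNIV" using clopen[of "range h"] by auto
  then have "c \<in> range h" by simp
  then show ?thesis by (auto simp: h_def)
qed

text \<open>Solutions that start at time \<open>- n\<close> in the negative plane through \<open>w (- n)\<close> can be steered to have
coordinates \<open>c\<close> at time 0. Their difference to \<open>w\<close> starts with \<open>V \<le> 0\<close>, so the squeezing inequality
bounds it by \<open>M * exp (- lam * t)\<close> uniformly in \<open>n\<close>, and a limit as \<open>n\<close> grows is amenable.\<close>

lemma amenable_exists: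
  assumes w: "amenable w"
  shows "\<exists>u. amenable u \<and> Q (u 0) = c"
proof -
  note wt = amenable_complete[OF w]
  have "\<exists>z. kap \<le> real n \<longrightarrow> Q (\<phi> (real n) (w (- real n) + j z)) = c" for n :: nat
    using negative_plane_onto by blast
  then obtain z where z: "\<And>n. kap \<le> real n \<Longrightarrow> Q (\<phi> (real n) (w (- real n) + j (z n))) = c" by metis
  define u where "u n t = \<phi> (t + real n) (w (- real n) + j (z n))" for n t
  have traj: "trajectory_from \<phi> (- real n) (u n)" for n
    by (auto simp: trajectory_from_def u_def semiflow_add[symmetric] add.assoc)
  define M where "M = sqrt C * norm (c - Q (w 0))"
  have M0: "0 \<le> M" using C by (simp add: M_def)
  have near: "norm (u n t - w t) \<le> M * exp (- lam * t)" if "- real n + kap \<le> t" "t \<le> 0" for n t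
  proof -
    have kn: "kap \<le> real n" using that by simp
    have "u n (- real n) - w (- real n) = j (z n)" by (simp add: u_def)
    then have "exp (2 * lam * (- real n)) * V (u n (- real n) - w (- real n)) \<le> 0"
      by (simp add: form_j mult_le_0_iff)
    moreover have "exp (2 * lam * t) * (norm (u n t - w t))\<^sup>2
        \<le> C * (exp (2 * lam * (- real n)) * V (u n (- real n) - w (- real n)) - exp (2 * lam * 0) * V (u n 0 - w 0))"
      by (rule squeeze_trajectories[OF traj complete_trajectory_from[OF wt] order_refl that])
    moreover have "- V (u n 0 - w 0) \<le> (norm (c - Q (w 0)))\<^sup>2"
      using form_ge[of "u n 0 - w 0"] z[OF kn] by (simp add: Q_diff u_def)
    ultimately have "exp (2 * lam * t) * (norm (u n t - w t))\<^sup>2 \<le> C * (norm (c - Q (w 0)))\<^sup>2"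
      using C by (smt (verit) exp_zero mult_left_mono mult_zero_right mult_cancel_right1)
    then have "(exp (lam * t) * norm (u n t - w t))\<^sup>2 \<le> M\<^sup>2"
      using C by (simp add: M_def power_mult_distrib exp_double[symmetric] algebra_simps)
    then have "exp (lam * t) * norm (u n t - w t) \<le> M" using M0 by (rule power2_le_imp_le)
    then show ?thesis by (simp add: exp_minus field_simps)
  qed
  have cpt: "\<exists>M\<ge>0. \<forall>S\<ge>0. \<exists>N B. bounded B \<and> kuratowski B \<le> ennreal (M * exp (lam * S)) \<and>
               (\<forall>n\<ge>N. u n (- real k) \<in> \<phi> S ` B)" for k
  proof (intro exI[of _ "2 * (M * exp (lam * real k))"] conjI allI impI)
    show "0 \<le> 2 * (M * exp (lam * real k))" using M0 by simp
    fix S :: real assume S: "0 \<le> S"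
    define s where "s = - real k - S"
    define B where "B = cball (w s) (M * exp (- lam * s))"
    obtain N :: nat where N: "real k + S + kap \<le> real N" using real_arch_simple by blast
    have "u n (- real k) \<in> \<phi> S ` B" if "N \<le> n" for n
    proof -
      have n: "real k + S + kap \<le> real n" using N that by (smt (verit) of_nat_le_iff)
      have "u n (- real k) = \<phi> S (u n s)"
        using trajectory_fromD[OF traj[of n], of s "- real k"] n kap S by (simp add: s_def)
      moreover have "u n s \<in> B"
        using near[of n s] n S by (simp add: B_def s_def dist_norm norm_minus_commute)
      ultimately show ?thesis by blast
    qed
    moreover have "kuratowski B \<le> ennreal (2 * (M * exp (lam * real k)) * exp (lam * S))"
    proof (rule order_trans[OF kuratowski_le_diameter], unfold B_def, rule bounded_cball, rule ennreal_leI)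
      have "diameter (cball (w s) (M * exp (- lam * s))) \<le> 2 * (M * exp (- lam * s))"
      proof (rule diameter_le)
        show "cball (w s) (M * exp (- lam * s)) \<noteq> {} \<or> 0 \<le> 2 * (M * exp (- lam * s))" using M0 by simp
        fix x y assume "x \<in> cball (w s) (M * exp (- lam * s))" "y \<in> cball (w s) (M * exp (- lam * s))"
        then show "norm (x - y) \<le> 2 * (M * exp (- lam * s))"
          using dist_triangle3[of x y "w s"] by (simp add: dist_norm)
      qed
      also have "2 * (M * exp (- lam * s)) = 2 * (M * exp (lam * real k)) * exp (lam * S)"
        by (simp add: s_def exp_add[symmetric] algebra_simps)
      finally show "diameter (cball (w s) (M * exp (- lam * s))) \<le> 2 * (M * exp (lam * real k)) * exp (lam * S)" .
    qed
    ultimately show "\<exists>N B. bounded B \<and> kuratowski B \<le> ennreal (2 * (M * exp (lam * real k)) * exp (lam * S)) \<and>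
               (\<forall>n\<ge>N. u n (- real k) \<in> \<phi> S ` B)" unfolding B_def by (metis bounded_cball)
  qed
  obtain r x where r: "strict_mono r"
    and x: "complete_trajectory \<phi> x" "\<And>t. (\<lambda>n. u (r n) t) \<longlonglongrightarrow> x t"
    by (rule limit_trajectory[OF traj cpt]) (rule that; assumption)
  have late: "\<exists>N. \<forall>n\<ge>N. - real (r n) + kap \<le> t" for t
  proof -
    obtain N :: nat where N: "kap - t \<le> real N" using real_arch_simple by blast
    have "- real (r n) + kap \<le> t" if "N \<le> n" for n
    proof -
      have "N \<le> r n" using seq_suble[OF r, of n] that by simp
      then show ?thesis using N by (smt (verit) of_nat_le_iff)
    qed
    then show ?thesis by blast
  qed
  obtain M' where M': "\<And>t. t \<le> 0 \<Longrightarrow> exp (lam * t) * norm (w t) \<le> M'"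
    using w by (auto simp: amenable_def)
  have "exp (lam * t) * norm (x t) \<le> M + M'" if "t \<le> 0" for t
  proof -
    obtain N where N: "\<And>n. N \<le> n \<Longrightarrow> - real (r n) + kap \<le> t" using late by blast
    have "norm (x t - w t) \<le> M * exp (- lam * t)"
      by (rule Lim_bounded[OF tendsto_norm[OF tendsto_diff[OF x(2)[of t] tendsto_const]], of N])
         (use near N that in blast)
    then have "exp (lam * t) * norm (x t - w t) \<le> M" by (simp add: exp_minus field_simps)
    moreover have "exp (lam * t) * norm (x t) \<le> exp (lam * t) * (norm (x t - w t) + norm (w t))"
      by (intro mult_left_mono norm_triangle_sub[THEN order_trans]) (auto simp: add.commute)
    ultimately show ?thesis using M'[OF that] by (simp add: distrib_left)
  qed
  then have "amenable x" unfolding amenable_def using x(1) by blast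
  moreover have "Q (x 0) = c"
  proof -
    obtain N where N: "\<And>n. N \<le> n \<Longrightarrow> - real (r n) + kap \<le> 0" using late[of 0] by blast
    have "\<forall>\<^sub>F n in sequentially. Q (u (r n) 0) = c"
      unfolding eventually_sequentially
    proof (intro exI[of _ N] allI impI)
      fix n assume "N \<le> n"
      then show "Q (u (r n) 0) = c" using z[of "r n"] N[of n] by (simp add: u_def)
    qed
    then have "(\<lambda>n. Q (u (r n) 0)) \<longlonglongrightarrow> c" by (rule tendsto_eventually)
    with Q_tendsto[OF x(2)[of 0]] show ?thesis by (rule LIMSEQ_unique)
  qed
  ultimately show ?thesis by blast
qed

end

section \<open>The inertial manifold as a plane\<close>

locale cone_semiflow_plane = cone_semiflow +
  assumes nonempty: "\<exists>w. amenable w"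
begin

definition traj_at :: "complex \<Rightarrow> real \<Rightarrow> 'a" where
  "traj_at c = (SOME u. amenable u \<and> Q (u 0) = c)"

lemma traj_at: "amenable (traj_at c)" "Q (traj_at c 0) = c"
proof -
  have "\<exists>u. amenable u \<and> Q (u 0) = c" using nonempty amenable_exists by blast
  from someI_ex[OF this] show "amenable (traj_at c)" "Q (traj_at c 0) = c"
    by (simp_all add: traj_at_def)
qed

lemma traj_at_eq: "amenable u \<Longrightarrow> traj_at (Q (u 0)) = u"
  by (rule amenable_unique[OF traj_at(1) _ traj_at(2)])

lemma traj_at_shift: "traj_at (Q (traj_at c s)) t = traj_at c (t + s)"
  using traj_at_eq[OF amenable_shift[OF traj_at(1)[of c], of s]] by (simp add: fun_eq_iff)

lemma traj_at_lipschitz: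
  "norm (traj_at c (- T) - traj_at d (- T)) \<le> sqrt C * exp (lam * T) * dist c d" if "0 \<le> T"
proof -
  have "exp (2 * lam * (- T)) * (norm (traj_at c (- T) - traj_at d (- T)))\<^sup>2
      \<le> C * exp (2 * lam * 0) * (norm (Q (traj_at c 0) - Q (traj_at d 0)))\<^sup>2"
    by (rule amenable_pair_Q[OF traj_at(1) traj_at(1)]) (use that in simp)
  then have "(norm (traj_at c (- T) - traj_at d (- T)))\<^sup>2 \<le> C * exp (2 * lam * T) * (dist c d)\<^sup>2"
    by (simp add: traj_at(2) dist_norm exp_minus field_simps)
  also have "\<dots> = (sqrt C * exp (lam * T) * dist c d)\<^sup>2"
    using C by (simp add: power_mult_distrib exp_double[symmetric] algebra_simps)
  finally show ?thesis by (rule power2_le_imp_le) (use C in simp)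
qed

lemma traj_at_forward: "0 \<le> t \<Longrightarrow> traj_at c (t + s) = \<phi> t (traj_at c s)"
  using amenable_complete[OF traj_at(1)[of c]] by (simp add: complete_trajectory_def)

lemma traj_at_continuous: "continuous_on UNIV (\<lambda>(t, c). traj_at c t)"
proof -
  have "isCont (\<lambda>(t, c). traj_at c t) (t, c)" for t c
  proof -
    obtain k :: nat where k: "- t < real k" using reals_Archimedean2 by blast
    have "continuous_on UNIV (\<lambda>c. traj_at c (- real k))"
      unfolding continuous_on_iff
    proof (intro ballI allI impI)
      fix c :: complex and e :: real assume "0 < e"
      define K where "K = sqrt C * exp (lam * real k)"
      have K: "0 < K" using C by (simp add: K_def)
      show "\<exists>d>0. \<forall>c'\<in>UNIV. dist c' c < d \<longrightarrow> dist (traj_at c' (- real k)) (traj_at c (- real k)) < e"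
      proof (intro exI[of _ "e / K"] conjI ballI impI)
        fix c' assume "dist c' c < e / K"
        then have "K * dist c' c < e" using K by (simp add: field_simps)
        with traj_at_lipschitz[of "real k" c' c]
        show "dist (traj_at c' (- real k)) (traj_at c (- real k)) < e" by (simp add: K_def dist_norm)
      qed (use K \<open>0 < e\<close> in simp)
    qed
    then have c1: "continuous_on ({- real k<..} \<times> UNIV) (\<lambda>p. \<phi> (fst p + real k) (traj_at (snd p) (- real k)))"
      by (intro semiflow_continuous_on continuous_intros continuous_on_compose2[where f = snd]) auto
    have eq: "\<phi> (s + real k) (traj_at d (- real k)) = traj_at d s" if "- real k < s" for s d
      using traj_at_forward[of "s + real k" d "- real k"] that by simp
    have "continuous_on ({- real k<..} \<times> UNIV) (\<lambda>(t, c). traj_at c t)"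
      by (rule continuous_on_eq[OF c1]) (auto simp: eq)
    moreover have "open ({- real k<..} \<times> (UNIV :: complex set))" by (intro open_Times) auto
    ultimately show ?thesis using k by (auto simp: continuous_on_eq_continuous_at)
  qed
  then show ?thesis by (simp add: continuous_on_eq_continuous_at split_paired_all)
qed

definition \<psi> :: "real \<Rightarrow> complex \<Rightarrow> complex" where "\<psi> t c = Q (traj_at c t)"
definition R :: "complex \<Rightarrow> 'a" where "R c = traj_at c 0"

lemma R_flow: "R (\<psi> t c) = traj_at c t"
  using traj_at_shift[of c t 0] by (simp add: R_def \<psi>_def)

lemma Q_R: "Q (R c) = c"
  by (simp add: R_def traj_at)

lemma R_continuous: "continuous_on UNIV R"
proof -
  have "continuous_on UNIV (\<lambda>c. (\<lambda>(t, c). traj_at c t) (0, c))"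
    by (intro continuous_on_compose2[OF traj_at_continuous] continuous_intros) auto
  then show ?thesis by (simp add: R_def[abs_def])
qed

lemma Q_continuous: "continuous_on UNIV Q"
  using bounded_linear.continuous_on[OF Q continuous_on_id] by simp

sublocale plane: plane_flow \<psi>
proof
  show "\<psi> 0 x = x" for x by (simp add: \<psi>_def traj_at)
  show "\<psi> (s + t) x = \<psi> s (\<psi> t x)" for s t x by (simp add: \<psi>_def traj_at_shift)
  show "continuous_on UNIV (\<lambda>(t, x). \<psi> t x)"
    using continuous_on_compose2[OF Q_continuous traj_at_continuous] by (simp add: \<psi>_def case_prod_beta)
qed

lemma semiflow_R: "0 \<le> t \<Longrightarrow> \<phi> t (R c) = R (\<psi> t c)"
  using traj_at_forward[of t c 0] by (simp add: R_flow) (simp add: R_def)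

text \<open>For each \<open>n\<close> choose the amenable trajectory that has the same coordinates as the given solution at
time \<open>n\<close>. There \<open>V\<close> of the difference is nonnegative, since it is negative only if the
coordinates differ, and by the decrease of the weighted form it is so at all times up to \<open>n - kap\<close>.
A limit of these trajectories makes the weighted form nonnegative forever; being decreasing, it is nearly
constant in the end, and then the squeezing inequality forces the difference to 0.\<close>

lemma asymptotic_phase:
  obtains c where "((\<lambda>t. \<phi> t v - R (\<psi> t c)) \<longlongrightarrow> 0) at_top"
proof -
  obtain w where w: "amenable w" using nonempty by blast
  define c where "c n = \<psi> (- real n) (Q (\<phi> (real n) v))" for n
  define D where "D c t = \<phi> t v - traj_at c t" for c t
  have Qn: "Q (traj_at (c n) (real n)) = Q (\<phi> (real n) v)" for n
    using plane.flow_inverse(1)[of "real n" "Q (\<phi> (real n) v)"] by (simp add: c_def \<psi>_def)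
  note tr = forward_trajectory[of v] complete_trajectory_from[OF amenable_complete[OF traj_at(1)], of 0]
  have nonneg_n: "0 \<le> V (D (c n) l)" if "0 \<le> l" "l + kap \<le> real n" for n l
  proof -
    have "0 \<le> V (D (c n) (real n))" using form_ge[of "D (c n) (real n)"] Qn[of n] by (simp add: D_def Q_diff)
    then have "0 \<le> exp (2 * lam * real n) * V (D (c n) (real n))" by simp
    also have "\<dots> \<le> exp (2 * lam * l) * V (D (c n) l)"
      unfolding D_def by (rule form_decreasing[OF tr that])
    finally show ?thesis by (simp add: zero_le_mult_iff)
  qed
  (* The starting points R (c n) are bounded: V is nonnegative on v - R (c n) and at most
     - (norm (a n))^2 / C on a n, so a n cannot be large compared with v - w 0. *)
  define b where "b = v - w 0"
  define a where "a n = traj_at (c n) 0 - w 0" for n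
  define K where "K = C * (\<bar>V b\<bar> + 2 * norm P * norm b)"
  have a_bound: "norm (a n) \<le> max 1 K" if "kap \<le> real n" for n
  proof (cases "norm (a n) \<le> 1")
    case False
    have "exp (2 * lam * 0) * (norm (a n))\<^sup>2 \<le> - C * (exp (2 * lam * 0) * V (a n))"
      unfolding a_def by (rule amenable_pair_form[OF traj_at(1) w order_refl])
    then have 1: "(norm (a n))\<^sup>2 \<le> C * - V (a n)" by simp
    have "D (c n) 0 = b - a n" by (simp add: D_def a_def b_def)
    then have "0 \<le> V (b - a n)" using nonneg_n[of 0 n] that by simp
    then have "- V (a n) \<le> V b - 2 * blinfun_apply (blinfun_apply P b) (a n)"
      using quad_form_diff[OF sym, of b "a n"] by simp
    also have "\<dots> \<le> \<bar>V b\<bar> + 2 * (norm P * norm b * norm (a n))"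
    proof -
      have "norm (blinfun_apply (blinfun_apply P b) (a n)) \<le> norm (blinfun_apply P b) * norm (a n)" by (rule norm_blinfun)
      also have "\<dots> \<le> (norm P * norm b) * norm (a n)" by (intro mult_right_mono norm_blinfun norm_ge_zero)
      finally show ?thesis unfolding real_norm_def by linarith
    qed
    also have "\<dots> \<le> \<bar>V b\<bar> * norm (a n) + 2 * (norm P * norm b * norm (a n))"
      using False by (simp add: mult_le_cancel_left1)
    finally have "C * - V (a n) \<le> C * (\<bar>V b\<bar> * norm (a n) + 2 * (norm P * norm b * norm (a n)))"
      using C by (intro mult_left_mono) auto
    also have "\<dots> = K * norm (a n)" by (simp add: K_def algebra_simps)
    finally have "norm (a n) * norm (a n) \<le> K * norm (a n)" using 1 by (simp add: power2_eq_square)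
    then have "norm (a n) \<le> K" using False by (auto simp: mult_le_cancel_right)
    then show ?thesis by simp
  qed simp
  obtain B where B: "\<And>v. norm (Q v) \<le> norm v * B" "0 < B" using bounded_linear.pos_bounded[OF Q] by blast
  obtain N0 :: nat where N0: "kap \<le> real N0" using real_arch_simple by blast
  have "bounded (range (\<lambda>n. c (n + N0)))"
    unfolding bounded_iff
  proof (intro exI[of _ "(max 1 K + norm (w 0)) * B"] ballI)
    fix x assume "x \<in> range (\<lambda>n. c (n + N0))"
    then obtain n where n: "x = c (n + N0)" by auto
    have "norm (traj_at x 0) \<le> norm (a (n + N0)) + norm (w 0)"
      using norm_triangle_sub[of "traj_at x 0" "w 0"] by (simp add: a_def n)
    also have "\<dots> \<le> max 1 K + norm (w 0)" using a_bound[of "n + N0"] N0 by simp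
    finally have "norm (traj_at x 0) * B \<le> (max 1 K + norm (w 0)) * B" using B(2) by (simp add: mult_right_mono)
    with B(1)[of "traj_at x 0"] show "norm x \<le> (max 1 K + norm (w 0)) * B" by (simp add: traj_at)
  qed
  then obtain c0 r where r: "strict_mono r" "((\<lambda>n. c (n + N0)) \<circ> r) \<longlonglongrightarrow> c0"
    using bounded_imp_convergent_subsequence by blast
  have nonneg: "0 \<le> V (D c0 l)" if l: "0 \<le> l" for l
  proof (rule LIMSEQ_le_const)
    have "isCont (\<lambda>(t, c). traj_at c t) (l, c0)" using traj_at_continuous by (simp add: continuous_on_eq_continuous_at)
    from isCont_tendsto_compose[OF this tendsto_Pair[OF tendsto_const r(2)]]
    have "(\<lambda>n. traj_at (c (r n + N0)) l) \<longlonglongrightarrow> traj_at c0 l" by simp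
    then show "(\<lambda>n. V (D (c (r n + N0)) l)) \<longlonglongrightarrow> V (D c0 l)"
      unfolding D_def by (intro tendsto_intros)
    obtain N :: nat where N: "l + kap \<le> real N" using real_arch_simple by blast
    have "0 \<le> V (D (c (r n + N0)) l)" if "N \<le> n" for n
    proof (rule nonneg_n[OF l])
      have "real N \<le> real (r n + N0)" using seq_suble[OF r(1), of n] that by simp
      with N show "l + kap \<le> real (r n + N0)" by linarith
    qed
    then show "\<exists>N. \<forall>n\<ge>N. 0 \<le> V (D (c (r n + N0)) l)" by blast
  qed
  define F where "F t = exp (2 * lam * t) * V (D c0 t)" for t
  define m where "m = (INF t\<in>{0..}. F t)"
  have bdd: "bdd_below (F ` {0..})" using nonneg by (intro bdd_belowI2[of _ 0]) (auto simp: F_def)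
  have "((\<lambda>t. D c0 t) \<longlongrightarrow> 0) at_top"
  proof (rule tendstoI)
    fix e :: real assume e: "0 < e"
    have "(INF t\<in>{0..}. F t) < m + e\<^sup>2 / C" using e C by (simp add: m_def)
    then obtain l where l: "0 \<le> l" "F l < m + e\<^sup>2 / C" using cINF_less_iff[OF _ bdd] by auto
    have "norm (D c0 t) < e" if t: "l + kap \<le> t" for t
    proof -
      have t0: "0 \<le> t" using l(1) kap t by simp
      then have "1 \<le> exp (2 * lam * t)" using lam by simp
      then have "(norm (D c0 t))\<^sup>2 \<le> exp (2 * lam * t) * (norm (D c0 t))\<^sup>2" by (simp add: mult_le_cancel_right1)
      also have "\<dots> \<le> C * (F l - F t)"
        unfolding F_def D_def by (rule squeeze_trajectories[OF tr l(1) t order_refl])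
      also have "\<dots> < C * (e\<^sup>2 / C)"
        using cINF_lower[OF bdd, of t] l(2) t0 C by (intro mult_strict_left_mono) (auto simp: m_def)
      finally have "(norm (D c0 t))\<^sup>2 < e\<^sup>2" using C by simp
      then show ?thesis by (rule power2_less_imp_less) (use e in simp)
    qed
    then show "\<forall>\<^sub>F t in at_top. dist (D c0 t) 0 < e"
      unfolding eventually_at_top_linorder by (auto simp: dist_norm)
  qed
  then show ?thesis using that[of c0] by (simp add: D_def R_flow)
qed

lemma R_limits:
  "omega_limit (\<lambda>t. R (x t)) = R ` omega_limit x" "alpha_limit (\<lambda>t. R (x t)) = R ` alpha_limit x"
  by (rule omega_limit_image[OF R_continuous Q_continuous Q_R])+

lemma stationary_R:
  assumes "\<And>t. \<psi> t z = z"
  shows "stationary_point \<phi> (R z)"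
  using assms by (simp add: stationary_point_def semiflow_R)

theorem poincare_bendixson_alternative:
  "periodic_orbit \<phi> (omega_limit (\<lambda>t. \<phi> t v)) \<or>
   (\<exists>N U. (\<forall>w\<in>N. stationary_point \<phi> w) \<and>
      (\<forall>u\<in>U. complete_trajectory \<phi> u \<and> alpha_limit u \<subseteq> N \<and> omega_limit u \<subseteq> N) \<and>
      omega_limit (\<lambda>t. \<phi> t v) = N \<union> (\<Union>u\<in>U. range u))"
proof -
  obtain c where "((\<lambda>t. \<phi> t v - R (\<psi> t c)) \<longlongrightarrow> 0) at_top" by (rule asymptotic_phase)
  from omega_limit_asymptotic[OF this]
  have \<Omega>: "omega_limit (\<lambda>t. \<phi> t v) = R ` omega_limit (\<lambda>t. \<psi> t c)" by (simp add: R_limits)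
  show ?thesis
  proof (cases rule: plane.plane_poincare_bendixson[of c])
    case (periodic y T h)
    have "range (\<lambda>t. \<psi> t y) = (\<lambda>t. \<psi> t y) ` {0..}"
      using plane.periodic_range[OF periodic(2,1)] by auto
    then have "omega_limit (\<lambda>t. \<phi> t v) = semiorbit \<phi> (R y)"
      unfolding \<Omega> periodic(4) semiorbit_def by (auto simp: semiflow_R image_image)
    moreover have "\<phi> T (R y) = R y" using periodic by (simp add: semiflow_R)
    moreover have "\<not> stationary_point \<phi> (R y)"
    proof
      assume "stationary_point \<phi> (R y)"
      then have "R (\<psi> t y) = R y" if "0 \<le> t" for t using that by (simp add: stationary_point_def semiflow_R)
      then have *: "\<psi> t y = y" if "0 \<le> t" for t using that by (metis Q_R)
      show False
      proof (cases "0 \<le> h")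
        case True
        with * periodic(3) show False by blast
      next
        case False
        then have "\<psi> (- h) y = y" by (intro *) simp
        then have "\<psi> h y = y" using plane.flow_inverse(1)[of h y] by simp
        with periodic(3) show False by blast
      qed
    qed
    ultimately show ?thesis unfolding periodic_orbit_def using periodic(1) by metis
  next
    case connecting
    define \<Omega>' where "\<Omega>' = omega_limit (\<lambda>t. \<psi> t c)"
    define S where "S = {z. \<forall>t. \<psi> t z = z}"
    have limits: "omega_limit (\<lambda>t. \<psi> t y) \<union> alpha_limit (\<lambda>t. \<psi> t y) \<subseteq> S" if "y \<in> \<Omega>'" for y
    proof
      fix z assume z: "z \<in> omega_limit (\<lambda>t. \<psi> t y) \<union> alpha_limit (\<lambda>t. \<psi> t y)"
      have "\<psi> t z = z" for t by (rule connecting[OF that[unfolded \<Omega>'_def] z])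
      then show "z \<in> S" unfolding S_def by blast
    qed
    define N where "N = R ` (S \<inter> \<Omega>')"
    define U where "U = (\<lambda>y t. R (\<psi> t y)) ` \<Omega>'"
    have N: "stationary_point \<phi> w" if "w \<in> N" for w
      using that by (auto simp: N_def S_def intro: stationary_R)
    have U: "complete_trajectory \<phi> u \<and> alpha_limit u \<subseteq> N \<and> omega_limit u \<subseteq> N" if "u \<in> U" for u
    proof -
      obtain y where y: "y \<in> \<Omega>'" "u = (\<lambda>t. R (\<psi> t y))" using \<open>u \<in> U\<close> by (auto simp: U_def)
      have "complete_trajectory \<phi> u"
        unfolding y(2) R_flow by (rule amenable_complete[OF traj_at(1)])
      moreover have "omega_limit (\<lambda>t. \<psi> t y) \<union> alpha_limit (\<lambda>t. \<psi> t y) \<subseteq> S \<inter> \<Omega>'"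
        using limits[OF y(1)] plane.limit_points_of_limit_points[OF y(1)[unfolded \<Omega>'_def]]
        unfolding \<Omega>'_def by auto
      ultimately show ?thesis unfolding y(2) R_limits N_def by blast
    qed
    have "omega_limit (\<lambda>t. \<phi> t v) = N \<union> (\<Union>u\<in>U. range u)"
    proof -
      have "R y \<in> (\<Union>u\<in>U. range u)" if "y \<in> \<Omega>'" for y
        using that by (auto simp: U_def intro!: bexI[of _ y] image_eqI[of _ _ 0])
      moreover have "R (\<psi> t y) \<in> R ` \<Omega>'" if "y \<in> \<Omega>'" for t y
        using plane.omega_limit_invariant[of y c t] that by (simp add: \<Omega>'_def)
      ultimately show ?thesis unfolding \<Omega> \<Omega>'_def[symmetric] by (auto simp: N_def U_def)
    qed
    then show ?thesis
      by (intro disjI2 exI[of _ N] exI[of _ U] conjI ballI N U[THEN conjunct1]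
          U[THEN conjunct2, THEN conjunct1] U[THEN conjunct2, THEN conjunct2])
  qed
qed

end

section \<open>Coordinates and norm control from the squeezing property\<close>

text \<open>A basis of \<open>Em\<close> that is orthonormal for \<open>- V\<close> gives \<open>j\<close>, and \<open>Q\<close> collects the coordinates of
the \<open>V\<close>-orthogonal projection to \<open>Em\<close>. On the \<open>V\<close>-orthogonal complement of \<open>Em\<close> the form is
nonnegative: if \<open>v' = p' + m\<close> is in it with \<open>p'\<close> in \<open>Ep\<close> and \<open>m\<close> in \<open>Em\<close>, then
\<open>V v' = V p' - V m\<close>.\<close>

lemma negative_plane_coordinates:
  fixes P :: "'e::real_normed_vector \<Rightarrow>\<^sub>L ('e \<Rightarrow>\<^sub>L real)"
  assumes sym: "symmetric_op P" and dec: "direct_sum_decomp Ep Em" and dim: "dim Em = 2"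
    and pos: "\<forall>v\<in>Ep - {0}. quad_form P v > 0" and neg: "\<forall>v\<in>Em - {0}. quad_form P v < 0"
  obtains Q :: "'e \<Rightarrow> complex" and j :: "complex \<Rightarrow> 'e" where
    "bounded_linear Q" "bounded_linear j"
    "\<And>v. - (norm (Q v))\<^sup>2 \<le> quad_form P v" "\<And>z. quad_form P (j z) = - (norm z)\<^sup>2"
proof -
  define b where "b v w = blinfun_apply (blinfun_apply P v) w" for v w
  have V: "quad_form P v = b v v" for v by (simp add: b_def quad_form_def)
  have b_sym: "b v w = b w v" for v w using sym by (simp add: symmetric_op_def b_def)
  note b_simps = blinfun.add_left blinfun.add_right blinfun.scaleR_left blinfun.scaleR_right
    blinfun.diff_left blinfun.diff_right blinfun.minus_left blinfun.minus_right
  have b_add: "b (u + v) w = b u w + b v w" "b w (u + v) = b w u + b w v"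
    and b_diff: "b (u - v) w = b u w - b v w" "b w (u - v) = b w u - b w v"
    and b_minus: "b w (- v) = - b w v" and b_scale: "b (r *\<^sub>R v) w = r * b v w" "b w (r *\<^sub>R v) = r * b w v" for u v w r
    by (simp_all add: b_def b_simps)
  have sub: "subspace Em" and split: "\<And>v. \<exists>p\<in>Ep. \<exists>m\<in>Em. v = p + m"
    using dec by (auto simp: direct_sum_decomp_def)
  obtain B where B: "B \<subseteq> Em" "independent B" "Em \<subseteq> span B" "card B = dim Em"
    using basis_exists by blast
  then obtain f1 f2 where f: "B = {f1, f2}" "f1 \<noteq> f2" using dim by (auto simp: card_2_iff)
  have normalize: "\<exists>e. e \<in> span {f} \<and> f \<in> span {e} \<and> b e e = - 1" if "f \<in> Em" "f \<noteq> 0" for f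
  proof -
    have n: "b f f < 0" using neg that by (simp add: V)
    define r where "r = 1 / sqrt (- b f f)"
    have r: "r \<noteq> 0" "r * r * b f f = - 1" using n by (simp_all add: r_def)
    have "f = (1 / r) *\<^sub>R (r *\<^sub>R f)" using r by simp
    then have "f \<in> span {r *\<^sub>R f}" by (metis span_base span_scale insertI1)
    moreover have "r *\<^sub>R f \<in> span {f}" by (simp add: span_base span_scale)
    moreover have "b (r *\<^sub>R f) (r *\<^sub>R f) = - 1" using r by (simp add: b_scale mult.assoc)
    ultimately show ?thesis by blast
  qed
  have f1: "f1 \<in> Em" "f1 \<noteq> 0" and f2: "f2 \<in> Em" using B f dependent_zero[of B] by auto
  obtain e1 where e1: "e1 \<in> span {f1}" "f1 \<in> span {e1}" "b e1 e1 = - 1" using normalize[OF f1] by blast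
  define g where "g = f2 + b f2 e1 *\<^sub>R e1"
  have e1Em: "e1 \<in> Em" using e1(1) f1(1) sub by (metis empty_subsetI insert_subset span_minimal subsetD)
  have gEm: "g \<in> Em" unfolding g_def by (intro subspace_add subspace_scale sub f2 e1Em)
  have g0: "g \<noteq> 0"
  proof
    assume "g = 0"
    then have "f2 = (- b f2 e1) *\<^sub>R e1" by (simp add: g_def eq_neg_iff_add_eq_0)
    then have "f2 \<in> span {f1}" using e1(1) span_scale by metis
    moreover have "f2 \<notin> span (B - {f2})" using B(2) f by (auto simp: dependent_def)
    moreover have "B - {f2} = {f1}" using f by auto
    ultimately show False by simp
  qed
  have ge: "b g e1 = 0" by (simp add: g_def b_add b_scale e1(3))
  obtain e2 where e2: "e2 \<in> span {g}" "g \<in> span {e2}" "b e2 e2 = - 1" using normalize[OF gEm g0] by blast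
  obtain k where k: "e2 = k *\<^sub>R g" using e2(1) by (auto simp: span_singleton)
  have e12: "b e2 e1 = 0" "b e1 e2 = 0" using ge b_sym[of e1 e2] by (simp_all add: k b_scale)
  have perp: "b m v = 0" if m: "m \<in> Em" and v: "b e1 v = 0" "b e2 v = 0" for m v
  proof -
    obtain c1 c2 where c: "f1 = c1 *\<^sub>R e1" "g = c2 *\<^sub>R e2" using e1(2) e2(2) by (auto simp: span_singleton)
    have z: "b f1 v = 0" "b f2 v = 0"
    proof -
      show "b f1 v = 0" by (simp add: c b_scale v)
      have "b g v = b f2 v + b f2 e1 * b e1 v" unfolding g_def by (simp add: b_add b_scale)
      then show "b f2 v = 0" by (simp add: c b_scale v)
    qed
    have "m \<in> span {f1, f2}" using m B f by auto
    moreover have "span {f1, f2} \<subseteq> {m. b m v = 0}"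
      by (rule span_minimal) (auto simp: z subspace_def b_add b_scale, simp add: b_def)
    ultimately show ?thesis by blast
  qed
  define Q where "Q v = Complex (- b e1 v) (- b e2 v)" for v
  define j where "j z = Re z *\<^sub>R e1 + Im z *\<^sub>R e2" for z
  have bl: "bounded_linear (\<lambda>v. - b e v)" for e
    unfolding b_def by (intro bounded_linear_minus blinfun.bounded_linear_right)
  have "Q = (\<lambda>v. complex_of_real (- b e1 v) + complex_of_real (- b e2 v) * \<i>)"
    by (simp add: fun_eq_iff Q_def complex_eq_iff)
  then have bQ: "bounded_linear Q"
    by (simp only:) (intro bounded_linear_add bounded_linear_mult_const
        bounded_linear_compose[OF bounded_linear_of_real bl])
  have bj: "bounded_linear j"
    unfolding j_def by (intro bounded_linear_add bounded_linear_scaleR_left[THEN bounded_linear_compose] bounded_linear_Re bounded_linear_Im)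
  have Vj: "quad_form P (j z) = - (norm z)\<^sup>2" for z
    by (simp add: V j_def b_add b_scale e1 e2 e12 cmod_power2) (simp add: power2_eq_square)
  have VQ: "- (norm (Q v))\<^sup>2 \<le> quad_form P v" for v
  proof -
    define v' where "v' = v - j (Q v)"
    have p: "b e1 v' = 0" "b e2 v' = 0"
      by (simp_all add: v'_def j_def Q_def b_diff b_add b_scale b_minus e1 e2 e12)
    have jEm: "j (Q v) \<in> Em"
      unfolding j_def using sub e1Em gEm by (intro subspace_add subspace_scale) (simp_all add: k subspace_scale)
    obtain p' m where pm: "p' \<in> Ep" "m \<in> Em" "v' = p' + m" using split by blast
    have "0 \<le> quad_form P p'" using pos pm(1) by (cases "p' = 0") (simp add: quad_form_def, simp add: less_imp_le)
    moreover have "quad_form P m \<le> 0" using neg pm(2) by (cases "m = 0") (simp add: quad_form_def, simp add: less_imp_le)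
    moreover have "quad_form P p' = quad_form P v' + quad_form P m"
    proof -
      have "p' = v' - m" using pm(3) by simp
      then show ?thesis using perp[OF pm(2) p] b_sym[of v' m] by (simp add: V b_diff)
    qed
    ultimately have "0 \<le> quad_form P v'" by linarith
    moreover have "quad_form P v = quad_form P v' + quad_form P (j (Q v))"
    proof -
      have "v = v' + j (Q v)" by (simp add: v'_def)
      then have "quad_form P v = quad_form P (v' + j (Q v))" by simp
      then show ?thesis using perp[OF jEm p] b_sym[of v' "j (Q v)"] by (simp add: V b_add)
    qed
    ultimately show ?thesis using Vj[of "Q v"] by simp
  qed
  show ?thesis by (rule that[OF bQ bj VQ Vj])
qed

text \<open>The smoothing part of the Lipschitz property bounds the distance at time \<open>t\<close> by a multiple of the
Hilbert space distance at each time between \<open>t - \<sigma> - 1\<close> and \<open>t - \<sigma>\<close>. Averaging over this interval, the squared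
distance is bounded by a multiple of the integral in the squeezing property.\<close>

lemma squeezing_controls_norm:
  fixes \<phi> :: "real \<Rightarrow> 'e \<Rightarrow> 'e::banach" and \<iota> :: "'e \<Rightarrow> 'h::{real_inner, complete_space}"
  assumes emb: "continuous_embedding \<iota>" and sf: "semiflow \<phi>"
    and sq: "squeezing_property \<iota> V \<phi> \<nu>m \<nu>p" and lip: "uniform_lipschitz_property \<iota> \<phi>"
  obtains lam kap C where "0 \<le> lam" "lam \<le> \<nu>p" "0 < kap" "0 < C"
    "\<And>l t r v1 v2. \<lbrakk>0 \<le> l; l + kap \<le> t; t \<le> r\<rbrakk> \<Longrightarrow>
      exp (2 * lam * t) * (norm (\<phi> t v1 - \<phi> t v2))\<^sup>2
        \<le> C * (exp (2 * lam * l) * V (\<phi> l v1 - \<phi> l v2) - exp (2 * lam * r) * V (\<phi> r v1 - \<phi> r v2))"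
proof -
  obtain \<delta> \<tau> lam where sq: "0 < \<delta>" "0 \<le> \<tau>" "0 \<le> lam" "lam \<le> \<nu>p"
    "\<And>v1 v2 r l. 0 \<le> r \<Longrightarrow> 0 \<le> l \<Longrightarrow> \<tau> \<le> r - l \<Longrightarrow>
       exp (2 * lam * r) * V (\<phi> r v1 - \<phi> r v2) - exp (2 * lam * l) * V (\<phi> l v1 - \<phi> l v2)
            \<le> - \<delta> * integral {l..r} (\<lambda>s. exp (2 * lam * s) * (norm (\<iota> (\<phi> s v1 - \<phi> s v2)))\<^sup>2)"
    using sq unfolding squeezing_property_def by blast
  obtain \<sigma> where \<sigma>: "0 \<le> \<sigma>" "\<And>T. 0 < T \<Longrightarrow> \<exists>L>0. \<forall>v1 v2.
        (\<forall>t\<in>{\<sigma>..\<sigma> + T}. norm (\<phi> t v1 - \<phi> t v2) \<le> L * norm (\<iota> (v1 - v2))) \<and>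
        (\<forall>t\<in>{0..T}. norm (\<phi> t v1 - \<phi> t v2) \<le> L * norm (v1 - v2))"
    using lip unfolding uniform_lipschitz_property_def by blast
  obtain L where L: "0 < L" "\<And>v1 v2 t. \<sigma> \<le> t \<Longrightarrow> t \<le> \<sigma> + 1 \<Longrightarrow> norm (\<phi> t v1 - \<phi> t v2) \<le> L * norm (\<iota> (v1 - v2))"
    using \<sigma>(2)[of 1] by auto
  define E where "E = L\<^sup>2 * exp (2 * lam * (\<sigma> + 1))"
  have E: "0 < E" using L by (simp add: E_def)
  have bl: "bounded_linear \<iota>" using emb by (simp add: continuous_embedding_def)
  have add: "\<phi> (t + s) v = \<phi> t (\<phi> s v)" if "0 \<le> t" "0 \<le> s" for t s v
    using sf that by (simp add: semiflow_def)
  have fcont: "continuous_on ({0..} \<times> UNIV) (\<lambda>(t, v). \<phi> t v)" using sf by (simp add: semiflow_def)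
  show ?thesis
  proof (rule that[of lam "\<sigma> + 1 + \<tau>" "E / \<delta>"])
    fix l t r v1 v2
    assume l: "0 \<le> l" and lt: "l + (\<sigma> + 1 + \<tau>) \<le> t" and tr: "t \<le> r"
    define f where "f s = exp (2 * lam * s) * (norm (\<iota> (\<phi> s v1 - \<phi> s v2)))\<^sup>2" for s
    have orb: "continuous_on {a..b} (\<lambda>s. \<phi> s v)" if "0 \<le> a" for a b v
    proof -
      have "continuous_on {a..b} (\<lambda>s. (\<lambda>(t, v). \<phi> t v) (s, v))"
        by (rule continuous_on_compose2[OF fcont]) (use that in \<open>auto intro!: continuous_intros\<close>)
      then show ?thesis by simp
    qed
    have int: "f integrable_on {a..b}" if "0 \<le> a" for a b
      unfolding f_def
      by (intro integrable_continuous_real continuous_intros bounded_linear.continuous_on[OF bl] orb that)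
    have pos: "0 \<le> f s" for s by (simp add: f_def)
    have "exp (2 * lam * t) * (norm (\<phi> t v1 - \<phi> t v2))\<^sup>2 \<le> E * f s" if s: "t - \<sigma> - 1 \<le> s" "s \<le> t - \<sigma>" for s
    proof -
      have s0: "0 \<le> s" using l lt sq(2) s by linarith
      have "\<phi> t v = \<phi> (t - s) (\<phi> s v)" for v
        using add[of "t - s" s v] s0 s \<sigma>(1) by simp
      then have "norm (\<phi> t v1 - \<phi> t v2) \<le> L * norm (\<iota> (\<phi> s v1 - \<phi> s v2))"
        using L(2)[of "t - s" "\<phi> s v1" "\<phi> s v2"] s by simp
      then have "(norm (\<phi> t v1 - \<phi> t v2))\<^sup>2 \<le> (L * norm (\<iota> (\<phi> s v1 - \<phi> s v2)))\<^sup>2" by (intro power_mono) auto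
      moreover have "exp (2 * lam * t) \<le> exp (2 * lam * (\<sigma> + 1)) * exp (2 * lam * s)"
      proof -
        have "lam * t \<le> lam * (\<sigma> + 1 + s)" using sq(3) s by (intro mult_left_mono) auto
        then show ?thesis by (simp add: exp_add[symmetric] algebra_simps)
      qed
      ultimately have "exp (2 * lam * t) * (norm (\<phi> t v1 - \<phi> t v2))\<^sup>2
          \<le> (exp (2 * lam * (\<sigma> + 1)) * exp (2 * lam * s)) * (L * norm (\<iota> (\<phi> s v1 - \<phi> s v2)))\<^sup>2"
        by (intro mult_mono) auto
      then show ?thesis by (simp add: E_def f_def power_mult_distrib algebra_simps)
    qed
    then have "integral {t - \<sigma> - 1..t - \<sigma>} (\<lambda>_. exp (2 * lam * t) * (norm (\<phi> t v1 - \<phi> t v2))\<^sup>2)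
        \<le> integral {t - \<sigma> - 1..t - \<sigma>} (\<lambda>s. E * f s)"
      using l lt sq(2) by (intro integral_le integrable_on_mult_right int) auto
    then have "exp (2 * lam * t) * (norm (\<phi> t v1 - \<phi> t v2))\<^sup>2 \<le> E * integral {t - \<sigma> - 1..t - \<sigma>} f" by simp
    also have "\<dots> \<le> E * integral {l..r} f"
      using E l lt tr sq(2) \<sigma>(1) pos by (intro mult_left_mono integral_subset_le int) auto
    also have "\<dots> \<le> E * ((exp (2 * lam * l) * V (\<phi> l v1 - \<phi> l v2) - exp (2 * lam * r) * V (\<phi> r v1 - \<phi> r v2)) / \<delta>)"
    proof (intro mult_left_mono)
      have "\<delta> * integral {l..r} f \<le> exp (2 * lam * l) * V (\<phi> l v1 - \<phi> l v2) - exp (2 * lam * r) * V (\<phi> r v1 - \<phi> r v2)"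
        using sq(5)[of r l v1 v2] l lt tr sq(2) \<sigma>(1) by (simp add: f_def[abs_def])
      then show "integral {l..r} f \<le> (exp (2 * lam * l) * V (\<phi> l v1 - \<phi> l v2) - exp (2 * lam * r) * V (\<phi> r v1 - \<phi> r v2)) / \<delta>"
        using sq(1) by (simp add: field_simps)
    qed (use E in simp)
    finally show "exp (2 * lam * t) * (norm (\<phi> t v1 - \<phi> t v2))\<^sup>2
        \<le> E / \<delta> * (exp (2 * lam * l) * V (\<phi> l v1 - \<phi> l v2) - exp (2 * lam * r) * V (\<phi> r v1 - \<phi> r v2))"
      by simp
  qed (use sq \<sigma> E in auto)
qed

lemma asymptotically_compact_weaken:
  assumes "asymptotically_compact \<phi> b" "a \<le> b"
  shows "asymptotically_compact \<phi> a"
proof -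
  obtain \<gamma>0 where \<gamma>: "\<forall>t\<ge>0. \<gamma>0 t \<ge> 0" "(\<gamma>0 \<longlongrightarrow> 0) at_top"
    "\<forall>t\<ge>0. \<forall>B. bounded B \<longrightarrow> kuratowski (\<phi> t ` B) \<le> ennreal (\<gamma>0 t * exp (- b * t)) * kuratowski B"
    using assms(1) unfolding asymptotically_compact_def by blast
  have "kuratowski (\<phi> t ` B) \<le> ennreal (\<gamma>0 t * exp (- a * t)) * kuratowski B" if "0 \<le> t" "bounded B" for t B
  proof -
    have "\<gamma>0 t * exp (- b * t) \<le> \<gamma>0 t * exp (- a * t)"
      using \<gamma>(1) that assms(2) by (intro mult_left_mono) (auto intro: mult_right_mono)
    then have "ennreal (\<gamma>0 t * exp (- b * t)) * kuratowski B \<le> ennreal (\<gamma>0 t * exp (- a * t)) * kuratowski B"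
      by (intro mult_right_mono ennreal_leI) auto
    with \<gamma>(3) that show ?thesis by (meson order_trans)
  qed
  with \<gamma>(1,2) show ?thesis unfolding asymptotically_compact_def by blast
qed

theorem theorem5p3p1:
  fixes \<phi> :: "real \<Rightarrow> 'e \<Rightarrow> 'e::banach"
    and \<iota> :: "'e \<Rightarrow> 'h::{real_inner, complete_space}"
    and P :: "'e \<Rightarrow>\<^sub>L ('e \<Rightarrow>\<^sub>L real)"
    and Ep Em :: "'e set"
    and \<nu>m \<nu>p :: real
    and v0 :: 'e
  assumes "continuous_embedding \<iota>"
    and "semiflow \<phi>"
    and "symmetric_op P"
    and "direct_sum_decomp Ep Em"
    and "dim Em = 2"
    and "\<forall>v\<in>Ep - {0}. quad_form P v > 0"
    and "\<forall>v\<in>Em - {0}. quad_form P v < 0"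
    and "squeezing_property \<iota> (quad_form P) \<phi> \<nu>m \<nu>p"
    and "asymptotically_compact \<phi> \<nu>p"
    and "uniform_lipschitz_property \<iota> \<phi>"
    and "bounded (semiorbit \<phi> v0)"
  shows
    "(\<exists>w. stationary_point \<phi> w \<and> omega_limit (\<lambda>t. \<phi> t v0) = {w}) \<or>
     periodic_orbit \<phi> (omega_limit (\<lambda>t. \<phi> t v0)) \<or>
     (\<exists>N U. (\<forall>w\<in>N. stationary_point \<phi> w) \<and>
        (\<forall>u\<in>U. complete_trajectory \<phi> u \<and> alpha_limit u \<subseteq> N \<and> omega_limit u \<subseteq> N) \<and>
        omega_limit (\<lambda>t. \<phi> t v0) = N \<union> (\<Union>u\<in>U. range u))"
proof -
  obtain Q :: "'e \<Rightarrow> complex" and j :: "complex \<Rightarrow> 'e" where Qj: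
    "bounded_linear Q" "bounded_linear j"
    "\<And>v. - (norm (Q v))\<^sup>2 \<le> quad_form P v" "\<And>z. quad_form P (j z) = - (norm z)\<^sup>2"
    by (rule negative_plane_coordinates[OF assms(3-7)]) (rule that; assumption)
  obtain lam kap C where K: "0 \<le> lam" "lam \<le> \<nu>p" "0 < kap" "0 < C"
    "\<And>l t r v1 v2. \<lbrakk>0 \<le> l; l + kap \<le> t; t \<le> r\<rbrakk> \<Longrightarrow>
      exp (2 * lam * t) * (norm (\<phi> t v1 - \<phi> t v2))\<^sup>2
        \<le> C * (exp (2 * lam * l) * quad_form P (\<phi> l v1 - \<phi> l v2) - exp (2 * lam * r) * quad_form P (\<phi> r v1 - \<phi> r v2))"
    by (rule squeezing_controls_norm[OF assms(1,2,8,10)]) (rule that; assumption)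
  have cone: "cone_semiflow \<phi> P Q j lam kap C"
    by (rule cone_semiflow.intro[OF assms(2,3) Qj K(1,3,4,5) asymptotically_compact_weaken[OF assms(9) K(2)]]; assumption)
  interpret cone_semiflow_plane \<phi> P Q j lam kap C
    by (intro cone_semiflow_plane.intro cone_semiflow_plane_axioms.intro cone
        cone_semiflow.bounded_semiorbit_amenable[OF cone assms(11)])
  show ?thesis using poincare_bendixson_alternative[of v0] by blast
qed

end
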